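(* Let $Sig$ be the set of isomorphism classes of derivable signatures of the type theory $TT_{Sig}$ described in the context, and let $FIC$ be the set of isomorphism classes of finite inverse categories whose objects are sort names and whose non-identity morphisms are variables. Then the assignments $R$ (signatures to finite inverse categories) and $S$ (finite inverse categories to signatures) described in the context induce well-defined maps $R\colon Sig\to FIC$ and $S\colon FIC\to Sig$, and these maps are mutually inverse. In particular $Sig$ and $FIC$ are in bijection.
   Context: Work in an extensional set theory. Fix disjoint countably infinite sets $Var$ (variables) and $SN$ (sort names), with a way of producing fresh elements not in any given finite subset. **Syntax of $TT_{Sig}$.** - Signatures: $\Psi ::= \bullet \mid \Psi, A:\Gamma$ with $A\in SN$. - Contexts: $\Gamma ::= \bullet \mid \Gamma, x:X$ with $x\in Var$. - Substitutions: $\sigma ::= \epsilon \mid (\sigma, t)$. - Terms: $t ::= x$ with $x \in Var$. - Sorts: $X ::= A\,\sigma$ with $A\in SN$. **Notation.** $A\notin\Psi$ (resp. $x\notin\Gamma$) means $A$ (resp. $x$) has not already been bound in $\Psi$ (resp. $\Gamma$). $A \,\#\, \Gamma$ and $x\,\#\,X$ mean freshness. $(A:\Delta)\in\Psi$ and $(x:X)\in\Gamma$ denote list membership. **Rules.** - (sig_empty) $\bullet\vdash$. - (sig_ext) from $\Psi\vdash$, $\Psi;\Gamma\vdash$ and $A\notin\Psi$, infer $\Psi, A:\Gamma\vdash$. - (ctx_empty) $\Psi;\bullet\vdash$. - (ctx_ext) from $\Psi;\Gamma\vdash$, $\Psi;\Gamma\vdash X$ and $x\notin\Gamma$, infer $\Psi;\Gamma,x:X\vdash$.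 - (sub_empty) $\Psi\vdash\epsilon:\Gamma\Rightarrow\bullet$. - (sub_ext) from $\Psi\vdash\sigma:\Gamma\Rightarrow\Delta$ and $\Psi;\Gamma\vdash z:\sigma(X)$, infer $\Psi\vdash(\sigma,z):\Gamma\Rightarrow\Delta,x:X$. - (type_var) from $(x:X)\in\Gamma$ and $\Psi;\Gamma\vdash$, infer $\Psi;\Gamma\vdash x:X$. - (type_sort) from $(A:\Delta)\in\Psi$ and $\Psi\vdash\sigma:\Gamma\Rightarrow\Delta$, infer $\Psi;\Gamma\vdash A\,\sigma$. - Congruence of contexts $\equiv$ is the equivalence relation generated by $\Gamma,x:X,y:Y,\Delta\equiv\Gamma,y:Y,x:X,\Delta$ whenever $x\,\#\,Y$ and $y\,\#\,X$. - Congruence of signatures is the equivalence relation generated by $\Psi,A:\Gamma,B:\Delta,\Phi\equiv\Psi,B:\Delta,A:\Gamma,\Phi$ whenever $A\,\#\,\Delta$ and $B\,\#\,\Gamma$. **Auxiliary definitions.** - $|\bullet|=\varnothing$ and $|\Gamma,x:X|=|\Gamma|\amalg\{x\}$. - For $Y\in SN$, $|\bullet|_Y=\varnothing$, and $|\Gamma,y:B\tau|_Y$ equals $|\Gamma|_Y\amalg\{y\}$ if $B=Y$ and $|\Gamma|_Y$ otherwise. - For a well-formed $\sigma:\Gamma\Rightarrow\Delta$, define $[\![\sigma]\!]:|\Delta|\to|\Gamma|$ by: $[\![\epsilon]\!]$ is the empty function, and $[\![\sigma,z]\!]$ on $|\Delta,x:X|$ sends $y\in|\Delta|$ to $[\![\sigma]\!](y)$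 and sends $x$ to $z$. - For $\sigma:\Gamma\Rightarrow\Delta$ and $\tau:\Delta\Rightarrow\Sigma$, define the composite $\sigma\cdot\tau$ by $\sigma\cdot\epsilon=\epsilon$ and $\sigma\cdot(\tau,z)=(\sigma\cdot\tau,[\![\sigma]\!](z))$. - The action on sorts is $\sigma(A\,\tau)=A\,(\sigma\cdot\tau)$. Two derivable signatures are isomorphic if they are congruent or $\alpha$-equivalent. $Sig$ is the set of isomorphism classes of $\Psi$ with $\Psi\vdash$ derivable. **Finite inverse categories.** A finite inverse category is a category with finitely many morphisms, no non-identity endomorphisms, and which is skeletal. $FIC$ denotes the set of isomorphism classes of finite inverse categories $\mathcal L$ with $\mathrm{ob}(\mathcal L)\subset SN$, non-identity morphisms forming a subset of $Var$, and identity morphisms written $1_K$. **The assignment $R$.** Defined by induction on derivations of signatures. - $R(\bullet)$ is the empty category. - $R(\Psi,K:\Gamma)$ has objects $\mathrm{ob}(R(\Psi))\amalg\{K\}$. - Its hom-sets are: $\hom(X,Y)=\hom_{R(\Psi)}(X,Y)$ for $X,Y\ne K$; $\hom(K,K)=\{1_K\}$; $\hom(X,K)=\varnothing$ for $X\neq K$; and $\hom(K,Y)=|\Gamma|_Y$ for $Y\ne K$. - Composition among old objects is that of $R(\Psi)$, and identities act as identities. - For $f\in|\Gamma|_Y$, with $(f: Y\,\sigma)\in\Gamma$ where $(Y:\Delta)\in\Psi$ and $\sigma:\Gamma\Rightarrow\Delta$, and for a non-identity $g:Y\to Z$ (so $g$ is a variable of $\Delta$), set $g\circ f=[\![\sigma]\!](g)$.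 **The assignment $S$.** Let $\mathcal L$ be such a finite inverse category. - Choose a linear ordering $K_1,\dots,K_n$ of its objects such that whenever there is a non-identity morphism $K'\to K$, $K$ comes before $K'$. - For each object $K$, let $\downarrow K$ denote the set of non-identity morphisms with domain $K$. Choose a linear ordering of $\downarrow K$ such that whenever $g\circ f\in\downarrow K$ with $g$ non-identity, $g\circ f$ precedes $f$. - For $f\in\downarrow K$, write $K_f$ for the codomain of $f$. - If $f_1,\dots,f_n$ is the ordered list of $\downarrow K$, and for each $i$, $p_{i1},\dots,p_{im_i}$ is the ordered list of $\downarrow K_{f_i}$, define the context $T_K=(f_1:K_{f_1}(p_{11}\circ f_1,\dots,p_{1m_1}\circ f_1),\dots,f_n:K_{f_n}(p_{n1}\circ f_n,\dots,p_{nm_n}\circ f_n))$, where $(v_1,\dots,v_k)$ denotes the substitution $(\dots(\epsilon,v_1),\dots,v_k)$. - Set $S(\mathcal L)=K_1:T_{K_1},\dots,K_n:T_{K_n}$, and $S(\varnothing)=\bullet$.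
   Formalization: Isomorphism of signatures also includes congruence of the context of an entry, with later substitutions permuted accordingly (otherwise S depends on the chosen orderings); variables naming non-identity morphisms need only be distinct among morphisms with the same domain. *)

theory Defs
  imports Main
begin

datatype var = VName nat
datatype sname = SName nat

text \<open>Substitutions are lists of terms (= variables); the substitution
  (...(eps, t1), ..., tk) is the list [t1, ..., tk].  A sort A sigma is a pair.
  Contexts and signatures are lists, extended at the END:
  (Gamma, x:X) is Gamma @ [(x, X)] and (Psi, A:Gamma) is Psi @ [(A, Gamma)].\<close>
type_synonym subst = "var list"
type_synonym sort = "sname \<times> subst"
type_synonym ctx = "(var \<times> sort) list"
type_synonym sig = "(sname \<times> ctx) list"

definition ctx_vars :: "ctx \<Rightarrow> var list" where
  "ctx_vars \<Gamma> = map fst \<Gamma>"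

text \<open>[[sigma]] : |Delta| -> |Gamma| for sigma : Gamma => Delta\<close>
definition interp :: "subst \<Rightarrow> ctx \<Rightarrow> var \<Rightarrow> var" where
  "interp \<sigma> \<Delta> z = the (map_of (zip (ctx_vars \<Delta>) \<sigma>) z)"

definition subst_comp :: "subst \<Rightarrow> ctx \<Rightarrow> subst \<Rightarrow> subst" where
  "subst_comp \<sigma> \<Delta> \<tau> = map (interp \<sigma> \<Delta>) \<tau>"

definition subst_sort :: "subst \<Rightarrow> ctx \<Rightarrow> sort \<Rightarrow> sort" where
  "subst_sort \<sigma> \<Delta> X = (fst X, subst_comp \<sigma> \<Delta> (snd X))"

inductive sig_wf :: "sig \<Rightarrow> bool"
  and ctx_wf :: "sig \<Rightarrow> ctx \<Rightarrow> bool"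
  and sub_wf :: "sig \<Rightarrow> subst \<Rightarrow> ctx \<Rightarrow> ctx \<Rightarrow> bool"
  and tm_wf :: "sig \<Rightarrow> ctx \<Rightarrow> var \<Rightarrow> sort \<Rightarrow> bool"
  and sort_wf :: "sig \<Rightarrow> ctx \<Rightarrow> sort \<Rightarrow> bool"
where
  sig_empty: "sig_wf []"
| sig_ext: "sig_wf \<Psi> \<Longrightarrow> ctx_wf \<Psi> \<Gamma> \<Longrightarrow> A \<notin> fst ` set \<Psi> \<Longrightarrow> sig_wf (\<Psi> @ [(A, \<Gamma>)])"
| ctx_empty: "ctx_wf \<Psi> []"
| ctx_ext: "ctx_wf \<Psi> \<Gamma> \<Longrightarrow> sort_wf \<Psi> \<Gamma> X \<Longrightarrow> x \<notin> fst ` set \<Gamma>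
             \<Longrightarrow> ctx_wf \<Psi> (\<Gamma> @ [(x, X)])"
| sub_empty: "sub_wf \<Psi> [] \<Gamma> []"
| sub_ext: "sub_wf \<Psi> \<sigma> \<Gamma> \<Delta> \<Longrightarrow> tm_wf \<Psi> \<Gamma> z (subst_sort \<sigma> \<Delta> X)
             \<Longrightarrow> sub_wf \<Psi> (\<sigma> @ [z]) \<Gamma> (\<Delta> @ [(x, X)])"
| type_var: "(x, X) \<in> set \<Gamma> \<Longrightarrow> ctx_wf \<Psi> \<Gamma> \<Longrightarrow> tm_wf \<Psi> \<Gamma> x X"
| type_sort: "(A, \<Delta>) \<in> set \<Psi> \<Longrightarrow> sub_wf \<Psi> \<sigma> \<Gamma> \<Delta> \<Longrightarrow> sort_wf \<Psi> \<Gamma> (A, \<sigma>)"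

definition sn_fresh :: "sname \<Rightarrow> ctx \<Rightarrow> bool" where
  "sn_fresh A \<Gamma> \<longleftrightarrow> (\<forall>(x, B, \<tau>) \<in> set \<Gamma>. B \<noteq> A)"

definition var_fresh :: "var \<Rightarrow> sort \<Rightarrow> bool" where
  "var_fresh x X \<longleftrightarrow> x \<notin> set (snd X)"

definition sig_swap :: "sig \<Rightarrow> sig \<Rightarrow> bool" where
  "sig_swap \<Psi> \<Psi>' \<longleftrightarrow> (\<exists>P A \<Gamma> B \<Delta> \<Phi>.
      \<Psi> = P @ [(A, \<Gamma>), (B, \<Delta>)] @ \<Phi> \<and> \<Psi>' = P @ [(B, \<Delta>), (A, \<Gamma>)] @ \<Phi>
      \<and> sn_fresh A \<Delta> \<and> sn_fresh B \<Gamma>)"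

definition swap_at :: "nat \<Rightarrow> subst \<Rightarrow> subst" where
  "swap_at i \<tau> = \<tau>[i := \<tau> ! Suc i, Suc i := \<tau> ! i]"

text \<open>re-indexing of every use  A tau  inside an entry, after the context of A
  has had its positions i and i+1 swapped\<close>
definition adjust_entry :: "sname \<Rightarrow> nat \<Rightarrow> sname \<times> ctx \<Rightarrow> sname \<times> ctx" where
  "adjust_entry A i E = (fst E, map (\<lambda>(z, B, \<tau>). (z, B, if B = A then swap_at i \<tau> else \<tau>)) (snd E))"

text \<open>generating step of congruence of contexts, applied to the context of an entry
  of the signature (the positional substitutions of later uses of that sort are
  permuted accordingly)\<close>
definition sig_ctx_swap :: "sig \<Rightarrow> sig \<Rightarrow> bool" where
  "sig_ctx_swap \<Psi> \<Psi>' \<longleftrightarrow> (\<exists>P A G1 x X y Y G2 \<Phi>.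
      \<Psi> = P @ [(A, G1 @ [(x, X), (y, Y)] @ G2)] @ \<Phi>
      \<and> \<Psi>' = P @ [(A, G1 @ [(y, Y), (x, X)] @ G2)] @ map (adjust_entry A (length G1)) \<Phi>
      \<and> var_fresh x Y \<and> var_fresh y X)"

definition rename_sig :: "(sname \<Rightarrow> sname) \<Rightarrow> (nat \<Rightarrow> var \<Rightarrow> var) \<Rightarrow> sig \<Rightarrow> sig" where
  "rename_sig \<pi> \<rho> \<Psi> = map (\<lambda>(i, A, \<Gamma>).
       (\<pi> A, map (\<lambda>(x, B, \<tau>). (\<rho> i x, \<pi> B, map (\<rho> i) \<tau>)) \<Gamma>)) (zip [0..<length \<Psi>] \<Psi>)"

definition sig_alpha :: "sig \<Rightarrow> sig \<Rightarrow> bool" where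
  "sig_alpha \<Psi> \<Psi>' \<longleftrightarrow> (\<exists>\<pi> \<rho>. bij \<pi> \<and> (\<forall>i. bij (\<rho> i)) \<and> \<Psi>' = rename_sig \<pi> \<rho> \<Psi>)"

definition sig_iso :: "sig \<Rightarrow> sig \<Rightarrow> bool" where
  "sig_iso = equivclp (\<lambda>\<Psi> \<Psi>'. sig_swap \<Psi> \<Psi>' \<or> sig_ctx_swap \<Psi> \<Psi>' \<or> sig_alpha \<Psi> \<Psi>')"

text \<open>(In is_FIC below, the non-identity morphisms out of a fixed object are
  required to have pairwise distinct names, i.e. they form a subset of Var.)\<close>
text \<open>A morphism is either the identity 1_K or a non-identity morphism named by a
  variable f, tagged with its domain and codomain (M K K' f : K -> K').\<close>
datatype mor = Id sname | M sname sname var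

fun mdom :: "mor \<Rightarrow> sname" where
  "mdom (Id K) = K" | "mdom (M K K' f) = K"

fun mcod :: "mor \<Rightarrow> sname" where
  "mcod (Id K) = K" | "mcod (M K K' f) = K'"

fun mname :: "mor \<Rightarrow> var" where
  "mname (M K K' f) = f" | "mname (Id K) = undefined"

text \<open>cmp C g f is the composite g o f\<close>
record cat =
  cob :: "sname set"
  cmor :: "mor set"
  cmp :: "mor \<Rightarrow> mor \<Rightarrow> mor"

definition is_category :: "cat \<Rightarrow> bool" where
  "is_category C \<longleftrightarrow>
     (\<forall>K \<in> cob C. Id K \<in> cmor C)
   \<and> (\<forall>m \<in> cmor C. mdom m \<in> cob C \<and> mcod m \<in> cob C)
   \<and> (\<forall>f \<in> cmor C. \<forall>g \<in> cmor C. mcod f = mdom g \<longrightarrow>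
        cmp C g f \<in> cmor C \<and> mdom (cmp C g f) = mdom f \<and> mcod (cmp C g f) = mcod g)
   \<and> (\<forall>f \<in> cmor C. cmp C (Id (mcod f)) f = f \<and> cmp C f (Id (mdom f)) = f)
   \<and> (\<forall>f \<in> cmor C. \<forall>g \<in> cmor C. \<forall>h \<in> cmor C. mcod f = mdom g \<longrightarrow> mcod g = mdom h \<longrightarrow>
        cmp C h (cmp C g f) = cmp C (cmp C h g) f)"

definition is_FIC :: "cat \<Rightarrow> bool" where
  "is_FIC C \<longleftrightarrow> is_category C \<and> finite (cmor C)
   \<and> (\<forall>K f. M K K f \<notin> cmor C)
   \<and> (\<forall>K Y Y' f. M K Y f \<in> cmor C \<longrightarrow> M K Y' f \<in> cmor C \<longrightarrow> Y = Y')
   \<and> (\<forall>X \<in> cob C. \<forall>Y \<in> cob C. (\<exists>f \<in> cmor C. \<exists>g \<in> cmor C. mdom f = X \<and> mcod f = Y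
          \<and> mdom g = Y \<and> mcod g = X \<and> cmp C g f = Id X \<and> cmp C f g = Id Y) \<longrightarrow> X = Y)"

definition cat_iso :: "cat \<Rightarrow> cat \<Rightarrow> bool" where
  "cat_iso C D \<longleftrightarrow> (\<exists>\<phi> \<psi>. bij_betw \<phi> (cob C) (cob D) \<and> bij_betw \<psi> (cmor C) (cmor D)
     \<and> (\<forall>K \<in> cob C. \<psi> (Id K) = Id (\<phi> K))
     \<and> (\<forall>m \<in> cmor C. mdom (\<psi> m) = \<phi> (mdom m) \<and> mcod (\<psi> m) = \<phi> (mcod m))
     \<and> (\<forall>f \<in> cmor C. \<forall>g \<in> cmor C. mcod f = mdom g \<longrightarrow> \<psi> (cmp C g f) = cmp D (\<psi> g) (\<psi> f)))"

definition R_ext :: "sig \<Rightarrow> cat \<Rightarrow> sname \<Rightarrow> ctx \<Rightarrow> cat" where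
  "R_ext \<Psi> C K \<Gamma> = \<lparr> cob = cob C \<union> {K},
     cmor = cmor C \<union> {Id K} \<union> {M K Y f | f Y \<tau>. (f, (Y, \<tau>)) \<in> set \<Gamma> \<and> Y \<noteq> K},
     cmp = (\<lambda>g f. if mdom f = K then
               (case f of Id _ \<Rightarrow> g
                | M _ Y f' \<Rightarrow> (case g of Id _ \<Rightarrow> f
                    | M _ Z g' \<Rightarrow> M K Z (interp (snd (the (map_of \<Gamma> f'))) (the (map_of \<Psi> Y)) g')))
             else cmp C g f) \<rparr>"

fun R_rev :: "sig \<Rightarrow> cat" where
  "R_rev [] = \<lparr> cob = {}, cmor = {}, cmp = (\<lambda>g f. undefined) \<rparr>"
| "R_rev ((K, \<Gamma>) # \<Psi>r) = R_ext (rev \<Psi>r) (R_rev \<Psi>r) K \<Gamma>"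

definition R :: "sig \<Rightarrow> cat" where
  "R \<Psi> = R_rev (rev \<Psi>)"

definition down :: "cat \<Rightarrow> sname \<Rightarrow> mor set" where
  "down C K = {m \<in> cmor C. mdom m = K \<and> m \<noteq> Id K}"

definition adm_obj_order :: "cat \<Rightarrow> sname list \<Rightarrow> bool" where
  "adm_obj_order C os \<longleftrightarrow> distinct os \<and> set os = cob C
     \<and> (\<forall>m \<in> cmor C. m \<noteq> Id (mdom m) \<longrightarrow>
          (\<exists>i j. i < j \<and> j < length os \<and> os ! i = mcod m \<and> os ! j = mdom m))"

definition adm_down_order :: "cat \<Rightarrow> (sname \<Rightarrow> mor list) \<Rightarrow> bool" where
  "adm_down_order C ds \<longleftrightarrow> (\<forall>K \<in> cob C. distinct (ds K) \<and> set (ds K) = down C K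
     \<and> (\<forall>f \<in> down C K. \<forall>g \<in> cmor C. mdom g = mcod f \<longrightarrow> g \<noteq> Id (mdom g) \<longrightarrow>
          cmp C g f \<in> down C K \<longrightarrow>
          (\<exists>i j. i < j \<and> j < length (ds K) \<and> ds K ! i = cmp C g f \<and> ds K ! j = f)))"

definition T_ctx :: "cat \<Rightarrow> (sname \<Rightarrow> mor list) \<Rightarrow> sname \<Rightarrow> ctx" where
  "T_ctx C ds K = map (\<lambda>f. (mname f, (mcod f, map (\<lambda>p. mname (cmp C p f)) (ds (mcod f))))) (ds K)"

definition S :: "cat \<Rightarrow> sname list \<Rightarrow> (sname \<Rightarrow> mor list) \<Rightarrow> sig" where
  "S C os ds = map (\<lambda>K. (K, T_ctx C ds K)) os"

end

theory Submission
  imports Defs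
begin

text \<open>A derivable signature is the same thing as a finite inverse category \<open>L\<close> together with
  admissible orderings: \<open>\<Psi> = S (R \<Psi>) os ds\<close> literally, where \<open>os\<close> and \<open>ds\<close> are the orders in
  which \<open>\<Psi>\<close> lists its sorts and the variables of their contexts, and conversely
  \<open>R (S L os ds)\<close> has the objects, morphisms and composites of \<open>L\<close>. Typing of a
  substitution \<open>\<sigma>\<close> in \<open>f : Y \<sigma>\<close> says that \<open>g \<mapsto> g \<circ> f\<close> is defined with the right codomain and
  is associative; scoping says that the orderings are admissible. Under this correspondence a
  swap of signature entries, a swap of context entries and an \<open>\<alpha>\<close>-renaming become an adjacent
  transposition in \<open>os\<close>, one in some \<open>ds K\<close>, and a renaming of \<open>L\<close>. Any two linear extensions
  of a finite order are connected by adjacent transpositions through linear extensions, and every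
  isomorphism of finite inverse categories is a renaming, so both equivalences match.\<close>

section \<open>Derivability as a flat condition\<close>

text \<open>The typing rules check every entry against the prefix before it, which is awkward under
  reordering. The flat condition therefore types each substitution over the whole context and the
  whole signature and records the prefix condition separately as scoping; scoping is what makes the
  two readings agree.

  This also shapes the invariance proofs. A swapped or renamed signature is never typed again: it is
  exhibited as \<open>S\<close> of the same category with a changed admissible order, or of a
  renamed copy. Since \<open>S\<close> yields derivable signatures and \<open>R\<close> undoes
  \<open>S\<close>, derivability and the isomorphism of categories follow at once. Congruence of
  contexts permutes positional substitutions in all later entries, which in this picture is just the
  effect of listing the composites \<open>p \<circ> f\<close> in another order of the
  \<open>p\<close>.\<close>

lemma tm_wf_iff: "tm_wf \<Psi> \<Gamma> x X \<longleftrightarrow> (x, X) \<in> set \<Gamma> \<and> ctx_wf \<Psi> \<Gamma>"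
  by (auto intro: type_var elim: tm_wf.cases)

lemma sort_wf_iff: "sort_wf \<Psi> \<Gamma> (A, \<sigma>) \<longleftrightarrow> (\<exists>\<Delta>. (A, \<Delta>) \<in> set \<Psi> \<and> sub_wf \<Psi> \<sigma> \<Gamma> \<Delta>)"
  by (auto intro: type_sort elim: sort_wf.cases)

lemma ctx_wf_snoc_iff:
  "ctx_wf \<Psi> (\<Gamma> @ [(x, X)]) \<longleftrightarrow> ctx_wf \<Psi> \<Gamma> \<and> sort_wf \<Psi> \<Gamma> X \<and> x \<notin> fst ` set \<Gamma>"
proof
  assume "ctx_wf \<Psi> (\<Gamma> @ [(x, X)])"
  then show "ctx_wf \<Psi> \<Gamma> \<and> sort_wf \<Psi> \<Gamma> X \<and> x \<notin> fst ` set \<Gamma>"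
    by cases auto
qed (blast intro: ctx_ext)

lemma sub_wf_Nil_iff: "sub_wf \<Psi> \<sigma> \<Gamma> [] \<longleftrightarrow> \<sigma> = []"
  by (auto intro: sub_empty elim: sub_wf.cases)

lemma sub_wf_snoc_iff:
  "sub_wf \<Psi> \<sigma> \<Gamma> (\<Delta> @ [(x, X)]) \<longleftrightarrow>
     (\<exists>\<sigma>' z. \<sigma> = \<sigma>' @ [z] \<and> sub_wf \<Psi> \<sigma>' \<Gamma> \<Delta> \<and> tm_wf \<Psi> \<Gamma> z (subst_sort \<sigma>' \<Delta> X))"
proof
  assume "sub_wf \<Psi> \<sigma> \<Gamma> (\<Delta> @ [(x, X)])"
  then show "\<exists>\<sigma>' z. \<sigma> = \<sigma>' @ [z] \<and> sub_wf \<Psi> \<sigma>' \<Gamma> \<Delta> \<and> tm_wf \<Psi> \<Gamma> z (subst_sort \<sigma>' \<Delta> X)"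
    by cases auto
qed (blast intro: sub_ext)

lemma sig_wf_snoc_iff:
  "sig_wf (\<Psi> @ [(A, \<Gamma>)]) \<longleftrightarrow> sig_wf \<Psi> \<and> ctx_wf \<Psi> \<Gamma> \<and> A \<notin> fst ` set \<Psi>"
proof
  assume "sig_wf (\<Psi> @ [(A, \<Gamma>)])"
  then show "sig_wf \<Psi> \<and> ctx_wf \<Psi> \<Gamma> \<and> A \<notin> fst ` set \<Psi>"
    by cases auto
qed (blast intro: sig_ext)

section \<open>Substitutions as maps between contexts\<close>

lemma interp_snoc:
  assumes "length \<sigma> = length \<Delta>" and "v \<in> fst ` set \<Delta>"
  shows "interp (\<sigma> @ [z]) (\<Delta> @ [(x, X)]) v = interp \<sigma> \<Delta> v"
proof -
  have "v \<in> dom (map_of (zip (map fst \<Delta>) \<sigma>))"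
    using assms by (simp add: dom_map_of_conv_image_fst flip: set_map)
  then obtain t where "map_of (zip (map fst \<Delta>) \<sigma>) v = Some t" by blast
  then show ?thesis
    using assms(1) by (simp add: interp_def ctx_vars_def zip_append map_add_def)
qed

lemma interp_in_zip:
  assumes "distinct (map fst \<Delta>)" "((v, X), t) \<in> set (zip \<Delta> \<sigma>)"
  shows "interp \<sigma> \<Delta> v = t"
proof -
  from assms(2) obtain i where i: "i < length \<Delta>" "i < length \<sigma>" "\<Delta> ! i = (v, X)" "\<sigma> ! i = t"
    by (auto simp: in_set_zip)
  have "(v, t) \<in> set (zip (map fst \<Delta>) \<sigma>)"
    using i by (force simp: in_set_zip)
  moreover have "distinct (map fst (zip (map fst \<Delta>) \<sigma>))"
    using assms(1) by (simp add: map_fst_zip_take distinct_take)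
  ultimately show ?thesis
    by (simp add: interp_def ctx_vars_def)
qed

text \<open>A substitution is recovered from the function it induces by listing the values in the
  order of \<open>\<Delta>\<close>. This is what turns composites in \<open>R \<Psi>\<close> back
  into the substitutions written in \<open>\<Psi>\<close>.\<close>

lemma map_interp_vars:
  assumes "distinct (map fst \<Delta>)" "length \<sigma> = length \<Delta>"
  shows "map (interp \<sigma> \<Delta>) (map fst \<Delta>) = \<sigma>"
proof (rule nth_equalityI)
  fix i assume "i < length (map (interp \<sigma> \<Delta>) (map fst \<Delta>))"
  then have i: "i < length \<Delta>" by simp
  then have "((fst (\<Delta> ! i), snd (\<Delta> ! i)), \<sigma> ! i) \<in> set (zip \<Delta> \<sigma>)"
    using assms(2) by (auto simp: in_set_zip)
  then show "map (interp \<sigma> \<Delta>) (map fst \<Delta>) ! i = \<sigma> ! i"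
    using interp_in_zip[OF assms(1)] i by (metis length_map nth_map)
qed (simp add: assms)

definition ctx_scoped :: "ctx \<Rightarrow> bool" where
  "ctx_scoped \<Gamma> \<longleftrightarrow> distinct (map fst \<Gamma>) \<and>
     (\<forall>i < length \<Gamma>. set (snd (snd (\<Gamma> ! i))) \<subseteq> fst ` set (take i \<Gamma>))"

lemma ctx_scoped_Nil: "ctx_scoped []"
  by (simp add: ctx_scoped_def)

lemma ctx_scoped_snoc:
  "ctx_scoped (\<Gamma> @ [(x, Y, \<tau>)]) \<longleftrightarrow> ctx_scoped \<Gamma> \<and> x \<notin> fst ` set \<Gamma> \<and> set \<tau> \<subseteq> fst ` set \<Gamma>"
  by (auto simp: ctx_scoped_def nth_append All_less_Suc)

lemma ctx_scoped_vars: "ctx_scoped \<Gamma> \<Longrightarrow> (x, Y, \<tau>) \<in> set \<Gamma> \<Longrightarrow> set \<tau> \<subseteq> fst ` set \<Gamma>"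
proof -
  assume a: "ctx_scoped \<Gamma>" "(x, Y, \<tau>) \<in> set \<Gamma>"
  then obtain i where "i < length \<Gamma>" "\<Gamma> ! i = (x, Y, \<tau>)" by (auto simp: in_set_conv_nth)
  then have "set \<tau> \<subseteq> fst ` set (take i \<Gamma>)"
    using a(1) unfolding ctx_scoped_def by (metis snd_conv)
  then show ?thesis using set_take_subset[of i \<Gamma>] by blast
qed

text \<open>Typing of \<open>\<sigma>\<close> with \<open>interp\<close> taken for all of
  \<open>\<Delta>\<close> instead of the prefix before each entry. If \<open>\<sigma>\<close> is the
  substitution in the sort of \<open>f\<close>, it says that \<open>g \<circ> f\<close> has the
  codomain of \<open>g\<close> and that \<open>h \<circ> (g \<circ> f)\<close> and
  \<open>(h \<circ> g) \<circ> f\<close> have the same name.\<close>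

definition inst_ok :: "subst \<Rightarrow> ctx \<Rightarrow> ctx \<Rightarrow> bool" where
  "inst_ok \<sigma> \<Gamma> \<Delta> \<longleftrightarrow> length \<sigma> = length \<Delta> \<and>
     (\<forall>g Z \<upsilon> t. ((g, Z, \<upsilon>), t) \<in> set (zip \<Delta> \<sigma>) \<longrightarrow> (t, Z, map (interp \<sigma> \<Delta>) \<upsilon>) \<in> set \<Gamma>)"

text \<open>By scoping, the sort of an entry of \<open>\<Delta>\<close> mentions only earlier
  variables, on which \<open>interp\<close> does not change when the substitution is extended. The
  proviso \<open>\<Delta> \<noteq> []\<close> mirrors the rules: \<open>sub_empty\<close> asks
  nothing of \<open>\<Gamma>\<close>, whereas each term comes from \<open>type_var\<close>, which
  demands \<open>ctx_wf\<close>.\<close>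

lemma sub_wf_iff:
  "ctx_scoped \<Delta> \<Longrightarrow> sub_wf \<Psi> \<sigma> \<Gamma> \<Delta> \<longleftrightarrow> inst_ok \<sigma> \<Gamma> \<Delta> \<and> (\<Delta> \<noteq> [] \<longrightarrow> ctx_wf \<Psi> \<Gamma>)"
proof (induction \<Delta> arbitrary: \<sigma> rule: rev_induct)
  case Nil
  then show ?case by (auto simp: sub_wf_Nil_iff inst_ok_def)
next
  case (snoc e \<Delta>)
  obtain x Z \<upsilon> where e: "e = (x, Z, \<upsilon>)" by (cases e)
  have sc: "ctx_scoped \<Delta>" "set \<upsilon> \<subseteq> fst ` set \<Delta>"
    using snoc.prems by (auto simp: e ctx_scoped_snoc)
  have *: "inst_ok (\<sigma>' @ [z]) \<Gamma> (\<Delta> @ [e]) \<longleftrightarrow>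
      inst_ok \<sigma>' \<Gamma> \<Delta> \<and> (z, subst_sort \<sigma>' \<Delta> (Z, \<upsilon>)) \<in> set \<Gamma>" for \<sigma>' z
  proof (cases "length \<sigma>' = length \<Delta>")
    case True
    have eq: "map (interp (\<sigma>' @ [z]) (\<Delta> @ [e])) \<tau> = map (interp \<sigma>' \<Delta>) \<tau>"
      if "set \<tau> \<subseteq> fst ` set \<Delta>" for \<tau>
      using that True by (auto simp: e interp_snoc subset_iff)
    have eq': "map (interp (\<sigma>' @ [z]) (\<Delta> @ [e])) \<tau> = map (interp \<sigma>' \<Delta>) \<tau>"
      if "((g, Y, \<tau>), t) \<in> set (zip \<Delta> \<sigma>')" for g Y \<tau> t
      using eq ctx_scoped_vars[OF sc(1)] set_zip_leftD[OF that] by blast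
    have "inst_ok (\<sigma>' @ [z]) \<Gamma> (\<Delta> @ [e]) \<longleftrightarrow>
      (\<forall>g Y \<tau> t. ((g, Y, \<tau>), t) \<in> set (zip \<Delta> \<sigma>') \<longrightarrow>
          (t, Y, map (interp (\<sigma>' @ [z]) (\<Delta> @ [e])) \<tau>) \<in> set \<Gamma>) \<and>
      (z, Z, map (interp (\<sigma>' @ [z]) (\<Delta> @ [e])) \<upsilon>) \<in> set \<Gamma>"
      using True unfolding inst_ok_def by (auto simp: e zip_append)
    also have "\<dots> \<longleftrightarrow> inst_ok \<sigma>' \<Gamma> \<Delta> \<and> (z, Z, map (interp \<sigma>' \<Delta>) \<upsilon>) \<in> set \<Gamma>"
      using eq[OF sc(2)] True eq' unfolding inst_ok_def by (metis (no_types, lifting))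
    finally show ?thesis by (simp add: subst_sort_def subst_comp_def)
  qed (auto simp: inst_ok_def)
  show ?case
  proof (cases \<sigma> rule: rev_cases)
    case Nil
    then show ?thesis by (simp add: e sub_wf_snoc_iff inst_ok_def)
  next
    case (snoc \<sigma>' z)
    then show ?thesis
      using snoc.IH[OF sc(1)] * by (auto simp: e sub_wf_snoc_iff tm_wf_iff)
  qed
qed

definition ctx_ok :: "sig \<Rightarrow> ctx \<Rightarrow> bool" where
  "ctx_ok \<Psi> \<Gamma> \<longleftrightarrow> ctx_scoped \<Gamma> \<and>
     (\<forall>f Y \<tau>. (f, Y, \<tau>) \<in> set \<Gamma> \<longrightarrow> (\<exists>\<Delta>. (Y, \<Delta>) \<in> set \<Psi> \<and> inst_ok \<tau> \<Gamma> \<Delta>))"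

lemma inst_ok_mono: "inst_ok \<sigma> \<Gamma> \<Delta> \<Longrightarrow> set \<Gamma> \<subseteq> set \<Gamma>' \<Longrightarrow> inst_ok \<sigma> \<Gamma>' \<Delta>"
  by (auto simp: inst_ok_def)

lemma inst_ok_vars: "inst_ok \<sigma> \<Gamma> \<Delta> \<Longrightarrow> set \<sigma> \<subseteq> fst ` set \<Gamma>"
proof
  fix t assume *: "inst_ok \<sigma> \<Gamma> \<Delta>" "t \<in> set \<sigma>"
  then obtain e where "(e, t) \<in> set (zip \<Delta> \<sigma>)"
    by (metis (no_types, lifting) inst_ok_def in_set_impl_in_set_zip2)
  then show "t \<in> fst ` set \<Gamma>"
    using *(1) by (cases e) (force simp: inst_ok_def)
qed

text \<open>The entry of the context hit by an entry of \<open>\<Delta>\<close> is named by an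
  element of \<open>\<sigma>\<close>, so the last entry, named \<open>x\<close>, is never
  hit.\<close>

lemma inst_ok_strengthen:
  assumes "inst_ok \<sigma> (\<Gamma> @ [(x, X)]) \<Delta>" "x \<notin> set \<sigma>"
  shows "inst_ok \<sigma> \<Gamma> \<Delta>"
  unfolding inst_ok_def
proof (intro conjI allI impI)
  fix g Z \<upsilon> t assume t: "((g, Z, \<upsilon>), t) \<in> set (zip \<Delta> \<sigma>)"
  then have "t \<noteq> x" using assms(2) set_zip_rightD by fastforce
  then show "(t, Z, map (interp \<sigma> \<Delta>) \<upsilon>) \<in> set \<Gamma>"
    using assms(1) t by (fastforce simp: inst_ok_def)
qed (use assms(1) in \<open>simp add: inst_ok_def\<close>)

text \<open>Going from prefixes to the whole context is monotonicity of \<open>inst_ok\<close>. The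
  way back rests on scoping: no sort of the extended context mentions its last variable, so every
  instance already lives in the shorter context.\<close>

lemma ctx_wf_iff:
  assumes "\<And>A \<Delta>. (A, \<Delta>) \<in> set \<Psi> \<Longrightarrow> ctx_scoped \<Delta>"
  shows "ctx_wf \<Psi> \<Gamma> \<longleftrightarrow> ctx_ok \<Psi> \<Gamma>"
proof (induction \<Gamma> rule: rev_induct)
  case Nil
  then show ?case by (simp add: ctx_ok_def ctx_scoped_Nil ctx_empty)
next
  case (snoc e \<Gamma>)
  obtain x Y \<tau> where e: "e = (x, Y, \<tau>)" by (cases e)
  have "ctx_wf \<Psi> (\<Gamma> @ [e]) \<longleftrightarrow>
      ctx_ok \<Psi> \<Gamma> \<and> x \<notin> fst ` set \<Gamma> \<and> (\<exists>\<Delta>. (Y, \<Delta>) \<in> set \<Psi> \<and> inst_ok \<tau> \<Gamma> \<Delta>)"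
    using snoc.IH assms by (auto simp: e ctx_wf_snoc_iff sort_wf_iff sub_wf_iff)
  also have "\<dots> \<longleftrightarrow> ctx_ok \<Psi> (\<Gamma> @ [e])"
  proof
    assume L: "ctx_ok \<Psi> \<Gamma> \<and> x \<notin> fst ` set \<Gamma> \<and> (\<exists>\<Delta>. (Y, \<Delta>) \<in> set \<Psi> \<and> inst_ok \<tau> \<Gamma> \<Delta>)"
    have mono: "inst_ok \<sigma> \<Gamma> \<Delta> \<Longrightarrow> inst_ok \<sigma> (\<Gamma> @ [e]) \<Delta>" for \<sigma> \<Delta>
      by (erule inst_ok_mono) auto
    have "ctx_scoped (\<Gamma> @ [e])"
      using L inst_ok_vars unfolding ctx_ok_def e ctx_scoped_snoc by blast
    moreover have "\<exists>\<Delta>. (Y', \<Delta>) \<in> set \<Psi> \<and> inst_ok \<tau>' (\<Gamma> @ [e]) \<Delta>"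
      if "(f, Y', \<tau>') \<in> set (\<Gamma> @ [e])" for f Y' \<tau>'
    proof -
      have "\<exists>\<Delta>. (Y', \<Delta>) \<in> set \<Psi> \<and> inst_ok \<tau>' \<Gamma> \<Delta>"
        using L that by (auto simp: e ctx_ok_def)
      then show ?thesis using mono by blast
    qed
    ultimately show "ctx_ok \<Psi> (\<Gamma> @ [e])"
      by (simp only: ctx_ok_def) blast
  next
    assume "ctx_ok \<Psi> (\<Gamma> @ [e])"
    then have sc: "ctx_scoped \<Gamma>" "x \<notin> fst ` set \<Gamma>" "set \<tau> \<subseteq> fst ` set \<Gamma>"
      and ok: "\<And>f Y' \<tau>'. (f, Y', \<tau>') \<in> set (\<Gamma> @ [e]) \<Longrightarrow>
                  \<exists>\<Delta>. (Y', \<Delta>) \<in> set \<Psi> \<and> inst_ok \<tau>' (\<Gamma> @ [e]) \<Delta>"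
      unfolding ctx_ok_def e ctx_scoped_snoc by auto
    have "\<exists>\<Delta>. (Y', \<Delta>) \<in> set \<Psi> \<and> inst_ok \<tau>' \<Gamma> \<Delta>" if "(f, Y', \<tau>') \<in> set (\<Gamma> @ [e])" for f Y' \<tau>'
    proof -
      have "set \<tau>' \<subseteq> fst ` set \<Gamma>"
        using that sc(3) ctx_scoped_vars[OF sc(1), of f Y' \<tau>'] by (auto simp: e)
      then have "x \<notin> set \<tau>'" using sc(2) by blast
      then show ?thesis
        using ok[OF that] inst_ok_strengthen unfolding e by blast
    qed
    then show "ctx_ok \<Psi> \<Gamma> \<and> x \<notin> fst ` set \<Gamma> \<and> (\<exists>\<Delta>. (Y, \<Delta>) \<in> set \<Psi> \<and> inst_ok \<tau> \<Gamma> \<Delta>)"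
      using sc by (auto simp: ctx_ok_def e)
  qed
  finally show ?case .
qed

lemma sig_wf_scoped: "sig_wf \<Psi> \<Longrightarrow> (A, \<Delta>) \<in> set \<Psi> \<Longrightarrow> ctx_scoped \<Delta>"
proof (induction \<Psi> arbitrary: A \<Delta> rule: rev_induct)
  case (snoc e \<Psi>)
  then show ?case
    using ctx_wf_iff[of \<Psi>] by (cases e) (auto simp: sig_wf_snoc_iff ctx_ok_def)
qed simp

section \<open>Dependency order of sorts; derivable signatures\<close>

definition sig_ordered :: "sig \<Rightarrow> bool" where
  "sig_ordered \<Psi> \<longleftrightarrow> (\<forall>i < length \<Psi>. (fst \<circ> snd) ` set (snd (\<Psi> ! i)) \<subseteq> fst ` set (take i \<Psi>))"

lemma sig_ordered_snoc:
  "sig_ordered (\<Psi> @ [(A, \<Gamma>)]) \<longleftrightarrow> sig_ordered \<Psi> \<and> (fst \<circ> snd) ` set \<Gamma> \<subseteq> fst ` set \<Psi>"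
  unfolding sig_ordered_def by (simp add: nth_append All_less_Suc conj_commute del: o_apply)

lemma sig_ordered_sorts:
  "sig_ordered \<Psi> \<Longrightarrow> (K, \<Gamma>) \<in> set \<Psi> \<Longrightarrow> (f, Y, \<tau>) \<in> set \<Gamma> \<Longrightarrow> Y \<in> fst ` set \<Psi>"
proof -
  assume a: "sig_ordered \<Psi>" "(K, \<Gamma>) \<in> set \<Psi>" "(f, Y, \<tau>) \<in> set \<Gamma>"
  then obtain i where "i < length \<Psi>" "\<Psi> ! i = (K, \<Gamma>)" by (auto simp: in_set_conv_nth)
  then have "(fst \<circ> snd) ` set \<Gamma> \<subseteq> fst ` set (take i \<Psi>)"
    using a(1) unfolding sig_ordered_def by (metis snd_conv)
  then show ?thesis using a(3) set_take_subset[of i \<Psi>] by force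
qed

lemma ctx_ok_mono: "ctx_ok \<Psi> \<Gamma> \<Longrightarrow> set \<Psi> \<subseteq> set \<Psi>' \<Longrightarrow> ctx_ok \<Psi>' \<Gamma>"
  unfolding ctx_ok_def by blast

lemma ctx_ok_sorts: "ctx_ok \<Psi> \<Gamma> \<Longrightarrow> (fst \<circ> snd) ` set \<Gamma> \<subseteq> fst ` set \<Psi>"
  by (force simp: ctx_ok_def)

lemma ctx_ok_strengthen:
  assumes "ctx_ok (\<Psi> @ [(A, \<Delta>)]) \<Gamma>" "(fst \<circ> snd) ` set \<Gamma> \<subseteq> fst ` set \<Psi>" "A \<notin> fst ` set \<Psi>"
  shows "ctx_ok \<Psi> \<Gamma>"
  unfolding ctx_ok_def
proof (intro conjI allI impI)
  fix f Y \<tau> assume f: "(f, Y, \<tau>) \<in> set \<Gamma>"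
  then have "Y \<in> fst ` set \<Psi>" using assms(2) by force
  then have "Y \<noteq> A" using assms(3) by blast
  then show "\<exists>\<Delta>. (Y, \<Delta>) \<in> set \<Psi> \<and> inst_ok \<tau> \<Gamma> \<Delta>"
    using assms(1) f unfolding ctx_ok_def by fastforce
qed (use assms(1) in \<open>simp add: ctx_ok_def\<close>)

text \<open>Of the conditions on the right, only scoping (inside \<open>ctx_ok\<close>) and \<open>sig_ordered\<close> depend
  on the order of the entries.\<close>
lemma sig_wf_iff:
  "sig_wf \<Psi> \<longleftrightarrow> distinct (map fst \<Psi>) \<and> sig_ordered \<Psi> \<and> (\<forall>A \<Gamma>. (A, \<Gamma>) \<in> set \<Psi> \<longrightarrow> ctx_ok \<Psi> \<Gamma>)"
proof (induction \<Psi> rule: rev_induct)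
  case Nil
  then show ?case by (simp add: sig_ordered_def sig_empty)
next
  case (snoc e \<Psi>)
  obtain K \<Gamma> where e: "e = (K, \<Gamma>)" by (cases e)
  have "sig_wf (\<Psi> @ [e]) \<longleftrightarrow> sig_wf \<Psi> \<and> ctx_ok \<Psi> \<Gamma> \<and> K \<notin> fst ` set \<Psi>"
    using ctx_wf_iff[of \<Psi>] sig_wf_scoped by (auto simp: e sig_wf_snoc_iff)
  also have "\<dots> \<longleftrightarrow> distinct (map fst (\<Psi> @ [e])) \<and> sig_ordered (\<Psi> @ [e]) \<and>
      (\<forall>A \<Delta>. (A, \<Delta>) \<in> set (\<Psi> @ [e]) \<longrightarrow> ctx_ok (\<Psi> @ [e]) \<Delta>)" (is "?L \<longleftrightarrow> ?R")
  proof
    assume ?L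
    moreover have "ctx_ok \<Psi> \<Delta> \<Longrightarrow> ctx_ok (\<Psi> @ [e]) \<Delta>" for \<Delta>
      by (erule ctx_ok_mono) auto
    ultimately show ?R
      using ctx_ok_sorts[of \<Psi> \<Gamma>] unfolding snoc.IH e sig_ordered_snoc
      by (simp del: o_apply)
  next
    assume R: ?R
    then have K: "K \<notin> fst ` set \<Psi>" and o: "sig_ordered \<Psi>" "(fst \<circ> snd) ` set \<Gamma> \<subseteq> fst ` set \<Psi>"
      by (auto simp: e sig_ordered_snoc)
    have "ctx_ok \<Psi> \<Delta>" if "(A, \<Delta>) \<in> set (\<Psi> @ [e])" for A \<Delta>
    proof (rule ctx_ok_strengthen[OF _ _ K])
      show "ctx_ok (\<Psi> @ [(K, \<Gamma>)]) \<Delta>" using R that by (auto simp: e)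
      show "(fst \<circ> snd) ` set \<Delta> \<subseteq> fst ` set \<Psi>"
      proof (cases "(A, \<Delta>) = e")
        case True
        then show ?thesis using o(2) by (simp add: e)
      next
        case False
        then have "(A, \<Delta>) \<in> set \<Psi>" using that by simp
        then have "Y \<in> fst ` set \<Psi>" if "(f, Y, \<tau>) \<in> set \<Delta>" for f Y \<tau>
          using sig_ordered_sorts[OF o(1) _ that] by blast
        then show ?thesis by auto
      qed
    qed
    then have "ctx_ok \<Psi> \<Gamma>" "\<And>A \<Delta>. (A, \<Delta>) \<in> set \<Psi> \<Longrightarrow> ctx_ok \<Psi> \<Delta>"
      unfolding e by auto
    then show ?L using R K o(1) by (simp add: snoc.IH e)
  qed
  finally show ?case .
qed

section \<open>Finite inverse categories\<close>

lemma R_snoc: "R (\<Psi> @ [(K, \<Gamma>)]) = R_ext \<Psi> (R \<Psi>) K \<Gamma>"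
  by (simp add: R_def)

lemma cob_R: "cob (R \<Psi>) = fst ` set \<Psi>"
proof (induction \<Psi> rule: rev_induct)
  case (snoc e \<Psi>)
  then show ?case by (cases e) (simp add: R_snoc R_ext_def)
qed (simp add: R_def)

lemma cmor_R:
  "distinct (map fst \<Psi>) \<Longrightarrow> sig_ordered \<Psi> \<Longrightarrow>
   cmor (R \<Psi>) = Id ` fst ` set \<Psi> \<union>
     {M K Y f | K Y f \<Gamma> \<tau>. (K, \<Gamma>) \<in> set \<Psi> \<and> (f, Y, \<tau>) \<in> set \<Gamma>}"
proof (induction \<Psi> rule: rev_induct)
  case (snoc e \<Psi>)
  obtain K \<Gamma> where e: "e = (K, \<Gamma>)" by (cases e)
  have "Y \<noteq> K" if "(f, Y, \<tau>) \<in> set \<Gamma>" for f Y \<tau>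
    using that snoc.prems by (force simp: e sig_ordered_snoc)
  then show ?case
    using snoc by (auto simp: e R_snoc R_ext_def sig_ordered_snoc; blast)
qed (simp add: R_def)

lemma cmp_R_Id_right:
  "distinct (map fst \<Psi>) \<Longrightarrow> K \<in> fst ` set \<Psi> \<Longrightarrow> cmp (R \<Psi>) g (Id K) = g"
proof (induction \<Psi> rule: rev_induct)
  case (snoc e \<Psi>)
  then show ?case by (cases e) (auto simp: R_snoc R_ext_def)
qed simp

lemma cmp_R_Id_left:
  "distinct (map fst \<Psi>) \<Longrightarrow> K \<in> fst ` set \<Psi> \<Longrightarrow> cmp (R \<Psi>) (Id Z) (M K Y f) = M K Y f"
proof (induction \<Psi> rule: rev_induct)
  case (snoc e \<Psi>)
  then show ?case by (cases e) (auto simp: R_snoc R_ext_def)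
qed simp

text \<open>\<open>R_ext\<close> fixes the composite when the entry of \<open>K\<close> is added,
  looking \<open>Y\<close> up in the prefix of that time; since \<open>Y\<close> is declared in that
  prefix and names are distinct, the lookup finds the \<open>\<Delta>\<close> of the whole
  signature. Later entries have names other than \<open>K\<close> and leave the composite
  alone.\<close>

lemma cmp_R:
  "\<lbrakk>distinct (map fst \<Psi>); sig_ordered \<Psi>; (K, \<Gamma>) \<in> set \<Psi>; distinct (map fst \<Gamma>);
    (f, Y, \<tau>) \<in> set \<Gamma>; (Y, \<Delta>) \<in> set \<Psi>\<rbrakk> \<Longrightarrow>
   cmp (R \<Psi>) (M Y' Z g) (M K Y f) = M K Z (interp \<tau> \<Delta> g)"
proof (induction \<Psi> rule: rev_induct)
  case (snoc e \<Psi>)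
  obtain A \<Theta> where e: "e = (A, \<Theta>)" by (cases e)
  have A: "A \<notin> fst ` set \<Psi>" and d: "distinct (map fst \<Psi>)" and o: "sig_ordered \<Psi>"
    using snoc.prems(1,2) by (auto simp: e sig_ordered_snoc)
  have "Y \<in> fst ` set \<Psi>"
  proof (cases "(K, \<Gamma>) = e")
    case True
    then show ?thesis using snoc.prems(2,5) by (force simp: e sig_ordered_snoc)
  next
    case False
    then have "(K, \<Gamma>) \<in> set \<Psi>" using snoc.prems(3) by simp
    then show ?thesis using sig_ordered_sorts[OF o _ snoc.prems(5)] by blast
  qed
  then have Y: "(Y, \<Delta>) \<in> set \<Psi>" using A snoc.prems(6) by (auto simp: e)
  show ?case
  proof (cases "(K, \<Gamma>) = e")
    case True
    have "map_of \<Psi> Y = Some \<Delta>" using Y d by simp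
    moreover have "map_of \<Gamma> f = Some (Y, \<tau>)" using snoc.prems(4,5) by simp
    ultimately show ?thesis using True by (simp add: e R_snoc R_ext_def)
  next
    case False
    then have K: "(K, \<Gamma>) \<in> set \<Psi>" using snoc.prems(3) by simp
    then have "K \<noteq> A" using A by force
    then show ?thesis
      using snoc.IH[OF d o K snoc.prems(4,5) Y] by (simp add: e R_snoc R_ext_def)
  qed
qed simp

section \<open>Down-sets and linear extensions\<close>

lemma mem_down_iff: "m \<in> down L K \<longleftrightarrow> m \<in> cmor L \<and> (\<exists>Y f. m = M K Y f)"
  by (cases m) (auto simp: down_def)

text \<open>Trades the existence of positions for the absence of inversions. The latter form passes
  to sublists and splits over appends, as the arguments with transpositions require.\<close>

lemma sorted_wrt_iff_before:
  assumes "distinct xs" "\<And>x. x \<in> set xs \<Longrightarrow> \<not> r x x"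
  shows "sorted_wrt (\<lambda>x y. \<not> r y x) xs \<longleftrightarrow>
    (\<forall>a\<in>set xs. \<forall>b\<in>set xs. r a b \<longrightarrow> (\<exists>i j. i < j \<and> j < length xs \<and> xs ! i = a \<and> xs ! j = b))"
    (is "?L \<longleftrightarrow> ?R")
proof
  assume L: ?L
  show ?R
  proof (intro ballI impI)
    fix a b assume ab: "a \<in> set xs" "b \<in> set xs" "r a b"
    then obtain i j where ij: "i < length xs" "j < length xs" "xs ! i = a" "xs ! j = b"
      by (auto simp: in_set_conv_nth)
    have "\<not> j < i" using L ij ab(3) by (auto simp: sorted_wrt_iff_nth_less)
    moreover have "i \<noteq> j" using ij ab assms(2) by auto
    ultimately show "\<exists>i j. i < j \<and> j < length xs \<and> xs ! i = a \<and> xs ! j = b"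
      using ij by (intro exI[of _ i] exI[of _ j]) auto
  qed
next
  assume R: ?R
  show ?L unfolding sorted_wrt_iff_nth_less
  proof (intro allI impI notI)
    fix i j assume ij: "i < j" "j < length xs" "r (xs ! j) (xs ! i)"
    then obtain i' j' where "i' < j'" "j' < length xs" "xs ! i' = xs ! j" "xs ! j' = xs ! i"
      using R[rule_format, of "xs ! j" "xs ! i"] by auto
    then have "i' = j" "j' = i"
      using ij assms(1) by (auto simp: nth_eq_iff_index_eq)
    then show False using ij(1) \<open>i' < j'\<close> by simp
  qed
qed

lemma sorted_wrt_sort_key:
  fixes k :: "'a \<Rightarrow> nat"
  assumes "\<And>x y. r x y \<Longrightarrow> k x < k y"
  shows "sorted_wrt (\<lambda>x y. \<not> r y x) (sort_key k xs)"
proof (rule sorted_wrt_mono_rel)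
  show "sorted_wrt (\<lambda>x y. k x \<le> k y) (sort_key k xs)"
    using sorted_sort_key[of k xs] by (simp add: sorted_map)
qed (use assms in \<open>fastforce\<close>)

definition obj_prec :: "cat \<Rightarrow> sname \<Rightarrow> sname \<Rightarrow> bool" where
  "obj_prec L Y K \<longleftrightarrow> (\<exists>f. M K Y f \<in> cmor L)"

definition mor_prec :: "cat \<Rightarrow> mor \<Rightarrow> mor \<Rightarrow> bool" where
  "mor_prec L h f \<longleftrightarrow> (\<exists>g\<in>cmor L. mdom g = mcod f \<and> g \<noteq> Id (mdom g) \<and> h = cmp L g f)"

definition T_entry :: "cat \<Rightarrow> (sname \<Rightarrow> mor list) \<Rightarrow> mor \<Rightarrow> var \<times> sort" where
  "T_entry L ds f = (mname f, mcod f, map (\<lambda>p. mname (cmp L p f)) (ds (mcod f)))"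

lemma T_ctx_eq: "T_ctx L ds K = map (T_entry L ds) (ds K)"
  by (simp add: T_ctx_def T_entry_def)

section \<open>Composition and admissible orders in a finite inverse category\<close>

locale fic =
  fixes L :: cat
  assumes is_FIC: "is_FIC L"
begin

lemma category: "is_category L"
  using is_FIC by (simp add: is_FIC_def)

lemma Id_mor: "K \<in> cob L \<Longrightarrow> Id K \<in> cmor L"
  using category by (simp add: is_category_def)

lemma mdom_ob: "m \<in> cmor L \<Longrightarrow> mdom m \<in> cob L"
  and mcod_ob: "m \<in> cmor L \<Longrightarrow> mcod m \<in> cob L"
  using category by (simp_all add: is_category_def)

lemma cmp_mor: "f \<in> cmor L \<Longrightarrow> g \<in> cmor L \<Longrightarrow> mcod f = mdom g \<Longrightarrow> cmp L g f \<in> cmor L"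
  and mdom_cmp: "f \<in> cmor L \<Longrightarrow> g \<in> cmor L \<Longrightarrow> mcod f = mdom g \<Longrightarrow> mdom (cmp L g f) = mdom f"
  and mcod_cmp: "f \<in> cmor L \<Longrightarrow> g \<in> cmor L \<Longrightarrow> mcod f = mdom g \<Longrightarrow> mcod (cmp L g f) = mcod g"
  using category by (simp_all add: is_category_def)

lemma cmp_Id_left: "f \<in> cmor L \<Longrightarrow> cmp L (Id (mcod f)) f = f"
  and cmp_Id_right: "f \<in> cmor L \<Longrightarrow> cmp L f (Id (mdom f)) = f"
  using category by (simp_all add: is_category_def)

lemma cmp_assoc:
  "f \<in> cmor L \<Longrightarrow> g \<in> cmor L \<Longrightarrow> h \<in> cmor L \<Longrightarrow> mcod f = mdom g \<Longrightarrow> mcod g = mdom h \<Longrightarrow>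
   cmp L (cmp L h g) f = cmp L h (cmp L g f)"
  using category unfolding is_category_def by metis

lemma finite_cmor: "finite (cmor L)"
  using is_FIC by (simp add: is_FIC_def)

lemma finite_cob: "finite (cob L)"
proof (rule finite_subset)
  show "cob L \<subseteq> mdom ` cmor L" using Id_mor by (force intro: rev_image_eqI)
qed (simp add: finite_cmor)

lemma finite_down: "finite (down L K)"
  by (rule finite_subset[OF _ finite_cmor]) (auto simp: down_def)

lemma no_endo: "M K K f \<notin> cmor L"
  using is_FIC by (simp add: is_FIC_def)

lemma cod_unique: "M K Y f \<in> cmor L \<Longrightarrow> M K Y' f \<in> cmor L \<Longrightarrow> Y = Y'"
  using is_FIC unfolding is_FIC_def by blast

lemma endo_Id: "m \<in> cmor L \<Longrightarrow> mdom m = K \<Longrightarrow> mcod m = K \<Longrightarrow> m = Id K"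
  using no_endo by (cases m) auto

text \<open>Both composites are endomorphisms, hence identities, so the two objects are isomorphic
  and skeletality identifies them; that leaves a non-identity endomorphism.\<close>

lemma no_cycle: "M K Y f \<in> cmor L \<Longrightarrow> M Y K g \<notin> cmor L"
proof
  assume f: "M K Y f \<in> cmor L" and g: "M Y K g \<in> cmor L"
  let ?f = "M K Y f" and ?g = "M Y K g"
  have "cmp L ?g ?f = Id K" "cmp L ?f ?g = Id Y"
    using f g by (intro endo_Id; simp add: cmp_mor mdom_cmp mcod_cmp)+
  moreover have "K \<in> cob L" "Y \<in> cob L" using mdom_ob[OF f] mdom_ob[OF g] by auto
  ultimately have "K = Y"
    using is_FIC f g unfolding is_FIC_def by (metis mdom.simps(2) mcod.simps(2))
  then show False using f no_endo by blast
qed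

lemma down_mor: "f \<in> down L K \<Longrightarrow> f \<in> cmor L"
  and down_dom: "f \<in> down L K \<Longrightarrow> mdom f = K"
  and down_cod: "f \<in> down L K \<Longrightarrow> mcod f \<in> cob L"
  and down_cod_neq: "f \<in> down L K \<Longrightarrow> mcod f \<noteq> K"
  using mcod_ob no_endo by (auto simp: mem_down_iff)

text \<open>The composite could be an identity only if the two arrows formed a cycle between two
  objects.\<close>

lemma cmp_down:
  assumes "f \<in> down L K" "g \<in> down L (mcod f)"
  shows "cmp L g f \<in> down L K"
proof -
  obtain Y f' Z g' where f: "f = M K Y f'" "f \<in> cmor L" and g: "g = M Y Z g'" "g \<in> cmor L"
    using assms by (auto simp: mem_down_iff)
  have "cmp L g f \<in> cmor L" "mdom (cmp L g f) = K" "mcod (cmp L g f) = Z"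
    using f g by (simp_all add: cmp_mor mdom_cmp mcod_cmp)
  moreover have "Z \<noteq> K" using no_cycle f g by blast
  ultimately show ?thesis by (cases "cmp L g f") (auto simp: mem_down_iff)
qed

lemma inj_on_mname: "inj_on mname (down L K)"
  using cod_unique by (fastforce simp: inj_on_def mem_down_iff)

lemma mor_prec_iff: "f \<in> down L K \<Longrightarrow> mor_prec L h f \<longleftrightarrow> (\<exists>g\<in>down L (mcod f). h = cmp L g f)"
  by (auto simp: mor_prec_def down_def)

text \<open>If \<open>f = g \<circ> f\<close> then \<open>g\<close> is an endomorphism of the
  codomain of \<open>f\<close>, hence an identity.\<close>

lemma mor_prec_irrefl: "f \<in> cmor L \<Longrightarrow> \<not> mor_prec L f f"
proof
  assume f: "f \<in> cmor L" and "mor_prec L f f"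
  then obtain g where g: "g \<in> cmor L" "mdom g = mcod f" "g \<noteq> Id (mdom g)" "f = cmp L g f"
    by (auto simp: mor_prec_def)
  then have "mcod f = mcod g" using f mcod_cmp[of f g] by simp
  then show False using g endo_Id[of g] by simp
qed

lemma adm_obj_order_iff:
  "adm_obj_order L os \<longleftrightarrow>
     distinct os \<and> set os = cob L \<and> sorted_wrt (\<lambda>X Y. \<not> obj_prec L Y X) os"
proof -
  have "(\<forall>m\<in>cmor L. m \<noteq> Id (mdom m) \<longrightarrow>
          (\<exists>i j. i < j \<and> j < length os \<and> os ! i = mcod m \<and> os ! j = mdom m)) \<longleftrightarrow>
      (\<forall>a\<in>set os. \<forall>b\<in>set os. obj_prec L a b \<longrightarrow>
          (\<exists>i j. i < j \<and> j < length os \<and> os ! i = a \<and> os ! j = b))" (is "?l = ?r")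
    if "set os = cob L"
  proof
    assume l: ?l
    show ?r
    proof (intro ballI impI)
      fix a b assume "obj_prec L a b"
      then obtain f where f: "M b a f \<in> cmor L" by (auto simp: obj_prec_def)
      show "\<exists>i j. i < j \<and> j < length os \<and> os ! i = a \<and> os ! j = b"
        using l[rule_format, OF f] by simp
    qed
  next
    assume r: ?r
    show ?l
    proof (intro ballI impI)
      fix m assume m: "m \<in> cmor L" "m \<noteq> Id (mdom m)"
      then have "obj_prec L (mcod m) (mdom m)"
        by (cases m) (auto simp: obj_prec_def)
      then show "\<exists>i j. i < j \<and> j < length os \<and> os ! i = mcod m \<and> os ! j = mdom m"
        using r[rule_format, of "mcod m" "mdom m"] m(1) mdom_ob mcod_ob that by simp
    qed
  qed
  then show ?thesis
    using sorted_wrt_iff_before[of os "obj_prec L"] no_endo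
    unfolding adm_obj_order_def obj_prec_def by blast
qed

lemma adm_down_order_iff:
  "adm_down_order L ds \<longleftrightarrow> (\<forall>K\<in>cob L. distinct (ds K) \<and> set (ds K) = down L K \<and>
     sorted_wrt (\<lambda>f h. \<not> mor_prec L h f) (ds K))"
proof -
  have "(\<forall>f \<in> down L K. \<forall>g \<in> cmor L. mdom g = mcod f \<longrightarrow> g \<noteq> Id (mdom g) \<longrightarrow>
          cmp L g f \<in> down L K \<longrightarrow>
          (\<exists>i j. i < j \<and> j < length (ds K) \<and> ds K ! i = cmp L g f \<and> ds K ! j = f)) \<longleftrightarrow>
      (\<forall>a\<in>set (ds K). \<forall>b\<in>set (ds K). mor_prec L a b \<longrightarrow>
          (\<exists>i j. i < j \<and> j < length (ds K) \<and> ds K ! i = a \<and> ds K ! j = b))"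
    if "set (ds K) = down L K" for K
    unfolding that mor_prec_def by blast
  note eq = this
  have "(distinct (ds K) \<and> set (ds K) = down L K \<and>
      (\<forall>f \<in> down L K. \<forall>g \<in> cmor L. mdom g = mcod f \<longrightarrow> g \<noteq> Id (mdom g) \<longrightarrow>
          cmp L g f \<in> down L K \<longrightarrow>
          (\<exists>i j. i < j \<and> j < length (ds K) \<and> ds K ! i = cmp L g f \<and> ds K ! j = f))) \<longleftrightarrow>
      (distinct (ds K) \<and> set (ds K) = down L K \<and>
        sorted_wrt (\<lambda>f h. \<not> mor_prec L h f) (ds K))" for K
  proof (rule conj_cong[OF refl], rule conj_cong[OF refl])
    assume d: "distinct (ds K)" and s: "set (ds K) = down L K"
    have "\<not> mor_prec L f f" if "f \<in> set (ds K)" for f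
      using that s mor_prec_irrefl down_mor by blast
    note sorted_wrt_iff_before[of "ds K" "mor_prec L", OF d this]
    then show "(\<forall>f \<in> down L K. \<forall>g \<in> cmor L. mdom g = mcod f \<longrightarrow> g \<noteq> Id (mdom g) \<longrightarrow>
          cmp L g f \<in> down L K \<longrightarrow>
          (\<exists>i j. i < j \<and> j < length (ds K) \<and> ds K ! i = cmp L g f \<and> ds K ! j = f)) \<longleftrightarrow>
        sorted_wrt (\<lambda>f h. \<not> mor_prec L h f) (ds K)"
      unfolding eq[OF s] by (rule sym)
  qed
  then show ?thesis unfolding adm_down_order_def by simp
qed

theorem adm_orders_exist: "\<exists>os ds. adm_obj_order L os \<and> adm_down_order L ds"
proof -
  \<comment> \<open>The rank counts the objects reachable by a non-identity morphism. A morphism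
    from \<open>K\<close> to \<open>Y\<close> makes everything reachable from \<open>Y\<close>
    reachable from \<open>K\<close>, and \<open>Y\<close> itself is reachable from \<open>K\<close>
    but not from \<open>Y\<close>, so ranks drop strictly along non-identity morphisms.\<close>
  define rk where "rk K = card {Y. obj_prec L Y K}" for K
  have rk: "rk Y < rk K" if YK: "obj_prec L Y K" for Y K
    unfolding rk_def
  proof (rule psubset_card_mono)
    have "{X. obj_prec L X K} \<subseteq> cob L"
      using mcod_ob by (force simp: obj_prec_def)
    then show "finite {X. obj_prec L X K}" using finite_cob finite_subset by blast
    obtain f where f: "M K Y f \<in> cmor L" using YK by (auto simp: obj_prec_def)
    have "obj_prec L X K" if "M Y X g \<in> cmor L" for X g
      using cmp_down[of "M K Y f" K "M Y X g"] mcod_cmp[OF f that] f that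
      by (auto simp: mem_down_iff obj_prec_def)
    then have "{X. obj_prec L X Y} \<subseteq> {X. obj_prec L X K}" by (auto simp: obj_prec_def)
    moreover have "\<not> obj_prec L Y Y" using no_endo by (simp add: obj_prec_def)
    ultimately show "{X. obj_prec L X Y} \<subset> {X. obj_prec L X K}" using YK by blast
  qed
  obtain os where os: "distinct os" "set os = cob L"
    using finite_distinct_list[OF finite_cob] by blast
  have "adm_obj_order L (sort_key rk os)"
    using os sorted_wrt_sort_key[of "obj_prec L" rk os] rk by (simp add: adm_obj_order_iff)
  moreover have "\<exists>xs. distinct xs \<and> set xs = down L K \<and> sorted_wrt (\<lambda>f h. \<not> mor_prec L h f) xs" for K
  proof -
    obtain xs where xs: "distinct xs" "set xs = down L K"
      using finite_distinct_list[OF finite_down] by blast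
    \<comment> \<open>Morphisms are ranked by codomain: \<open>g \<circ> f\<close> ends where
      \<open>g\<close> ends, strictly below the codomain of \<open>f\<close>. The conjunct
      \<open>f \<in> cmor L\<close> is built into the relation because the sorting lemma quantifies
      over all values of type \<open>mor\<close>; it is discharged on \<open>down L K\<close>
      afterwards.\<close>
    have "sorted_wrt (\<lambda>f h. \<not> (f \<in> cmor L \<and> mor_prec L h f)) (sort_key (rk \<circ> mcod) xs)"
    proof (rule sorted_wrt_sort_key)
      fix h f assume hf: "f \<in> cmor L \<and> mor_prec L h f"
      then obtain g where g: "g \<in> cmor L" "mdom g = mcod f" "g \<noteq> Id (mdom g)" "h = cmp L g f"
        by (auto simp: mor_prec_def)
      then have "obj_prec L (mcod g) (mcod f)"
        by (cases g) (auto simp: obj_prec_def)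
      then show "(rk \<circ> mcod) h < (rk \<circ> mcod) f"
        using rk g hf mcod_cmp[of f g] by simp
    qed
    then have "sorted_wrt (\<lambda>f h. \<not> mor_prec L h f) (sort_key (rk \<circ> mcod) xs)"
      by (rule sorted_wrt_mono_rel[rotated]) (use xs down_mor in auto)
    then show ?thesis using xs by (intro exI[of _ "sort_key (rk \<circ> mcod) xs"]) auto
  qed
  then have "\<exists>ds. adm_down_order L ds"
    unfolding adm_down_order_iff by metis
  ultimately show ?thesis by blast
qed

end

section \<open>The signature of an ordered finite inverse category\<close>

lemma (in fic) adm_obj_prec:
  assumes "adm_obj_order L os" "i < length os" "f \<in> down L (os ! i)"
  shows "mcod f \<in> set (take i os)"
proof -
  from assms(1,3) obtain i' j where "i' < j" "j < length os" "os ! i' = mcod f" "os ! j = os ! i"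
    unfolding adm_obj_order_def down_def by (metis (mono_tags, lifting) mem_Collect_eq)
  moreover have "distinct os" using assms(1) by (simp add: adm_obj_order_def)
  ultimately have "i' < i" "os ! i' = mcod f" using assms(2) by (auto simp: nth_eq_iff_index_eq)
  then show ?thesis using assms(2) by (auto simp: in_set_conv_nth)
qed

locale fic_ordered = fic +
  fixes os :: "sname list" and ds :: "sname \<Rightarrow> mor list"
  assumes os: "adm_obj_order L os" and ds: "adm_down_order L ds"
begin

lemma distinct_os: "distinct os" and set_os: "set os = cob L"
  using os by (simp_all add: adm_obj_order_def)

lemma distinct_ds: "K \<in> cob L \<Longrightarrow> distinct (ds K)"
  and set_ds: "K \<in> cob L \<Longrightarrow> set (ds K) = down L K"
  using ds by (simp_all add: adm_down_order_def)

lemma map_fst_T_ctx: "map fst (T_ctx L ds K) = map mname (ds K)"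
  by (simp add: T_ctx_eq T_entry_def)

lemma distinct_T_ctx: "K \<in> cob L \<Longrightarrow> distinct (map fst (T_ctx L ds K))"
  using inj_on_mname[of K] by (simp add: map_fst_T_ctx distinct_map distinct_ds set_ds)

lemma set_T_ctx: "K \<in> cob L \<Longrightarrow> set (T_ctx L ds K) = T_entry L ds ` down L K"
  by (simp add: T_ctx_eq set_ds)

text \<open>With \<open>h p\<close> the name of \<open>p \<circ> f\<close>, this says that the
  substitution in the sort of \<open>f\<close> induces precomposition with \<open>f\<close>.\<close>

lemma interp_T_ctx:
  assumes "K \<in> cob L" "p \<in> down L K"
  shows "interp (map h (ds K)) (T_ctx L ds K) (mname p) = h p"
proof (rule interp_in_zip[OF distinct_T_ctx[OF assms(1)]])
  have "p \<in> set (ds K)" using assms by (simp add: set_ds)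
  then have "(T_entry L ds p, h p) \<in> set (zip (T_ctx L ds K) (map h (ds K)))"
    by (auto simp: T_ctx_eq in_set_zip in_set_conv_nth)
  then show "((mname p, snd (T_entry L ds p)), h p) \<in> set (zip (T_ctx L ds K) (map h (ds K)))"
    by (simp add: T_entry_def)
qed

text \<open>The variables in the sort of \<open>f\<close> name the composites
  \<open>g \<circ> f\<close>, and an admissible order lists these before \<open>f\<close>.\<close>

lemma scoped_T_ctx:
  assumes K: "K \<in> cob L"
  shows "ctx_scoped (T_ctx L ds K)"
  unfolding ctx_scoped_def
proof (intro conjI allI impI subsetI)
  fix i v assume i: "i < length (T_ctx L ds K)" and v: "v \<in> set (snd (snd (T_ctx L ds K ! i)))"
  let ?f = "ds K ! i"
  have i': "i < length (ds K)" using i by (simp add: T_ctx_eq)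
  then have f: "?f \<in> down L K" using K set_ds nth_mem by blast
  have "set (ds (mcod ?f)) = down L (mcod ?f)" using set_ds down_cod[OF f] by blast
  then obtain g where g: "g \<in> down L (mcod ?f)" "v = mname (cmp L g ?f)"
    using v i' by (auto simp: T_ctx_eq T_entry_def)
  have "cmp L g ?f \<in> down L K" by (rule cmp_down[OF f g(1)])
  then obtain i' j where ij: "i' < j" "j < length (ds K)" "ds K ! i' = cmp L g ?f" "ds K ! j = ?f"
    using ds K f g unfolding adm_down_order_def
    by (metis (mono_tags, lifting) down_dom down_mor mem_Collect_eq down_def)
  then have "j = i" using distinct_ds[OF K] i' by (simp add: nth_eq_iff_index_eq)
  then have "cmp L g ?f \<in> set (take i (ds K))" using ij by (auto simp: in_set_conv_nth)
  then show "v \<in> fst ` set (take i (T_ctx L ds K))"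
    by (auto simp: T_ctx_eq take_map T_entry_def g(2) image_image)
qed (rule distinct_T_ctx[OF K])

lemma mem_S_iff: "(K, \<Gamma>) \<in> set (S L os ds) \<longleftrightarrow> K \<in> cob L \<and> \<Gamma> = T_ctx L ds K"
  using set_os by (auto simp: S_def)

lemma map_fst_S: "map fst (S L os ds) = os"
  by (simp add: S_def comp_def)

text \<open>Precomposition with \<open>f\<close> sends the entry of \<open>p\<close> to the entry of
  \<open>p \<circ> f\<close>; that the sorts match is the associativity law
  \<open>(q \<circ> p) \<circ> f = q \<circ> (p \<circ> f)\<close>.\<close>

lemma inst_ok_T_ctx:
  assumes f: "f \<in> down L K" and K: "K \<in> cob L"
  shows "inst_ok (map (\<lambda>p. mname (cmp L p f)) (ds (mcod f))) (T_ctx L ds K) (T_ctx L ds (mcod f))"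
    (is "inst_ok ?\<tau> _ ?\<Delta>")
  unfolding inst_ok_def
proof (intro conjI allI impI)
  fix g Z \<upsilon> t assume "((g, Z, \<upsilon>), t) \<in> set (zip ?\<Delta> ?\<tau>)"
  then obtain p where p: "p \<in> set (ds (mcod f))" "(g, Z, \<upsilon>) = T_entry L ds p" "t = mname (cmp L p f)"
    unfolding T_ctx_eq zip_map_map zip_same_conv_map by auto
  have Y: "mcod f \<in> cob L" by (rule down_cod[OF f])
  have pd: "p \<in> down L (mcod f)" using p(1) Y set_ds by blast
  have Z: "Z = mcod p" "\<upsilon> = map (\<lambda>q. mname (cmp L q p)) (ds Z)"
    using p(2) by (auto simp: T_entry_def)
  have Zob: "Z \<in> cob L" using down_cod[OF pd] Z(1) by simp
  have "interp ?\<tau> ?\<Delta> (mname (cmp L q p)) = mname (cmp L q (cmp L p f))" if "q \<in> set (ds Z)" for q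
  proof -
    have q: "q \<in> down L (mcod p)" using that Z(1) Zob set_ds by blast
    have "interp ?\<tau> ?\<Delta> (mname (cmp L q p)) = mname (cmp L (cmp L q p) f)"
      by (rule interp_T_ctx[OF Y cmp_down[OF pd q]])
    also have "cmp L (cmp L q p) f = cmp L q (cmp L p f)"
      using f pd q by (intro cmp_assoc) (auto simp: down_mor down_dom)
    finally show ?thesis .
  qed
  moreover have "mcod (cmp L p f) = Z"
    using mcod_cmp[of f p] f pd Z(1) by (auto simp: down_mor down_dom)
  ultimately have "(t, Z, map (interp ?\<tau> ?\<Delta>) \<upsilon>) = T_entry L ds (cmp L p f)"
    by (simp add: T_entry_def p(3) Z(2))
  then show "(t, Z, map (interp ?\<tau> ?\<Delta>) \<upsilon>) \<in> set (T_ctx L ds K)"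
    using set_T_ctx[OF K] cmp_down[OF f pd] by simp
qed (simp add: T_ctx_eq)

lemma ordered_S: "sig_ordered (S L os ds)"
  unfolding sig_ordered_def
proof (intro allI impI)
  fix i assume "i < length (S L os ds)"
  then have i: "i < length os" by (simp add: S_def)
  then have K: "os ! i \<in> cob L" using set_os nth_mem by blast
  have "(fst \<circ> snd) ` set (T_ctx L ds (os ! i)) = mcod ` down L (os ! i)"
    by (simp add: set_T_ctx[OF K] image_image T_entry_def)
  also have "\<dots> \<subseteq> set (take i os)"
    using adm_obj_prec[OF os i] by blast
  also have "set (take i os) = fst ` set (take i (S L os ds))"
    by (simp add: S_def take_map image_image)
  finally show "(fst \<circ> snd) ` set (snd (S L os ds ! i)) \<subseteq> fst ` set (take i (S L os ds))"
    using i by (simp add: S_def)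
qed

theorem sig_wf_S: "sig_wf (S L os ds)"
  unfolding sig_wf_iff
proof (intro conjI allI impI)
  fix K \<Gamma> assume "(K, \<Gamma>) \<in> set (S L os ds)"
  then have K: "K \<in> cob L" "\<Gamma> = T_ctx L ds K" by (auto simp: mem_S_iff)
  show "ctx_ok (S L os ds) \<Gamma>"
    unfolding ctx_ok_def
  proof (intro conjI allI impI)
    fix f Y \<tau> assume "(f, Y, \<tau>) \<in> set \<Gamma>"
    then obtain m where m: "m \<in> down L K" "(f, Y, \<tau>) = T_entry L ds m"
      by (auto simp: K(2) set_T_ctx[OF K(1)])
    then show "\<exists>\<Delta>. (Y, \<Delta>) \<in> set (S L os ds) \<and> inst_ok \<tau> \<Gamma> \<Delta>"
      using inst_ok_T_ctx[OF m(1) K(1)] down_cod[OF m(1)] by (auto simp: K(2) mem_S_iff T_entry_def)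
  qed (simp add: K scoped_T_ctx)
qed (simp_all add: map_fst_S distinct_os ordered_S)

text \<open>Objects and morphisms agree on the nose, and so do composites of composable pairs,
  whence the identity map is an isomorphism. Equality of the records cannot be expected, since
  \<open>cmp\<close> is a total function with arbitrary values elsewhere.\<close>

theorem cat_iso_R_S: "cat_iso (R (S L os ds)) L"
proof -
  let ?C = "R (S L os ds)"
  have d: "distinct (map fst (S L os ds))" by (simp add: map_fst_S distinct_os)
  have ob: "cob ?C = cob L"
    by (metis cob_R list.set_map map_fst_S set_os)
  have "cmor ?C = Id ` cob L \<union> {M K Y f |K Y f. M K Y f \<in> cmor L}"
    unfolding cmor_R[OF d ordered_S] ob[unfolded cob_R]
  proof (intro arg_cong2[where f = "(\<union>)"] refl Collect_cong iffI)
    fix m assume "\<exists>K Y f \<Gamma> \<tau>. m = M K Y f \<and> (K, \<Gamma>) \<in> set (S L os ds) \<and> (f, Y, \<tau>) \<in> set \<Gamma>"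
    then show "\<exists>K Y f. m = M K Y f \<and> M K Y f \<in> cmor L"
      by (auto simp: mem_S_iff set_T_ctx T_entry_def mem_down_iff)
  next
    fix m assume "\<exists>K Y f. m = M K Y f \<and> M K Y f \<in> cmor L"
    then obtain K Y f where m: "m = M K Y f" "M K Y f \<in> cmor L" by blast
    have K: "K \<in> cob L" using mdom_ob[OF m(2)] by simp
    have "T_entry L ds m \<in> set (T_ctx L ds K)"
      using m by (auto simp: set_T_ctx[OF K] mem_down_iff)
    then show "\<exists>K Y f \<Gamma> \<tau>. m = M K Y f \<and> (K, \<Gamma>) \<in> set (S L os ds) \<and> (f, Y, \<tau>) \<in> set \<Gamma>"
      using m K by (auto simp: mem_S_iff T_entry_def)
  qed
  also have "\<dots> = cmor L"
    using Id_mor mdom_ob by (auto, metis imageI mdom.simps(1) mor.exhaust)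
  finally have mor: "cmor ?C = cmor L" .
  have "cmp ?C g f = cmp L g f" if fg: "f \<in> cmor L" "g \<in> cmor L" "mcod f = mdom g" for f g
  proof (cases f)
    case (Id K)
    then have "K \<in> fst ` set (S L os ds)" using mdom_ob[OF fg(1)] ob by (simp add: cob_R)
    then show ?thesis using cmp_R_Id_right[OF d] cmp_Id_right[OF fg(2)] fg(3) Id by simp
  next
    case (M K Y x)
    then have K: "K \<in> cob L" using mdom_ob[OF fg(1)] by simp
    then have K': "K \<in> fst ` set (S L os ds)" using ob by (simp add: cob_R)
    show ?thesis
    proof (cases g)
      case (Id Z)
      then show ?thesis using cmp_R_Id_left[OF d K'] cmp_Id_left[OF fg(1)] fg(3) M by simp
    next
      case (M Y' Z y)
      then have g: "g = M Y Z y" using fg(3) \<open>f = M K Y x\<close> by simp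
      have fd: "f \<in> down L K" and gd: "g \<in> down L Y" using fg g \<open>f = M K Y x\<close> by (auto simp: mem_down_iff)
      have Y: "Y \<in> cob L" using mdom_ob[OF fg(2)] g by simp
      define \<tau> where "\<tau> = map (\<lambda>p. mname (cmp L p f)) (ds Y)"
      have "(x, Y, \<tau>) \<in> set (T_ctx L ds K)"
        using fd \<open>f = M K Y x\<close> by (force simp: set_T_ctx[OF K] T_entry_def \<tau>_def)
      then have "cmp ?C g f = M K Z (interp \<tau> (T_ctx L ds Y) y)"
        using cmp_R[OF d ordered_S, of K "T_ctx L ds K" x Y \<tau> "T_ctx L ds Y" Y Z y]
          K Y distinct_T_ctx[OF K] by (simp add: mem_S_iff g \<open>f = M K Y x\<close>)
      also have "interp \<tau> (T_ctx L ds Y) y = mname (cmp L g f)"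
        using interp_T_ctx[OF Y gd, of "\<lambda>p. mname (cmp L p f)"] by (simp add: \<tau>_def g)
      also have "M K Z (mname (cmp L g f)) = cmp L g f"
        using cmp_down[OF fd, of g] gd mcod_cmp[OF fg] by (auto simp: mem_down_iff g \<open>f = M K Y x\<close>)
      finally show ?thesis .
    qed
  qed
  then show ?thesis
    unfolding cat_iso_def ob mor by (intro exI[of _ id]) simp
qed

end

section \<open>The category of a derivable signature\<close>

text \<open>For \<open>F = interp \<tau> \<Delta>\<close> this is functoriality of the
  interpretation: the composite substitution induces the composite function.\<close>

lemma interp_map:
  assumes "length \<upsilon> = length \<Theta>" "h \<in> fst ` set \<Theta>"
  shows "interp (map F \<upsilon>) \<Theta> h = F (interp \<upsilon> \<Theta> h)"
proof -
  have "h \<in> dom (map_of (zip (map fst \<Theta>) \<upsilon>))"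
    using assms by (simp add: dom_map_of_conv_image_fst flip: set_map)
  moreover have "zip (map fst \<Theta>) (map F \<upsilon>) = map (\<lambda>(k, v). (k, F v)) (zip (map fst \<Theta>) \<upsilon>)"
    by (simp add: zip_map2)
  ultimately show ?thesis
    by (auto simp: interp_def ctx_vars_def map_of_map)
qed

text \<open>The first conclusion makes a composite a morphism with the right codomain; the second
  puts its name into the sort carrying \<open>\<tau>\<close>, so that scoping places it before that
  entry.\<close>

lemma inst_ok_interp:
  assumes "inst_ok \<tau> \<Gamma> \<Delta>" "distinct (map fst \<Delta>)" "(g, Z, \<upsilon>) \<in> set \<Delta>"
  shows "(interp \<tau> \<Delta> g, Z, map (interp \<tau> \<Delta>) \<upsilon>) \<in> set \<Gamma>" and "interp \<tau> \<Delta> g \<in> set \<tau>"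
proof -
  have "length \<Delta> = length \<tau>" using assms(1) by (simp add: inst_ok_def)
  then obtain t where t: "((g, Z, \<upsilon>), t) \<in> set (zip \<Delta> \<tau>)"
    using assms(3) in_set_impl_in_set_zip1 by metis
  then have "interp \<tau> \<Delta> g = t" using interp_in_zip[OF assms(2)] by blast
  then show "(interp \<tau> \<Delta> g, Z, map (interp \<tau> \<Delta>) \<upsilon>) \<in> set \<Gamma>" "interp \<tau> \<Delta> g \<in> set \<tau>"
    using t assms(1) set_zip_rightD[OF t] by (auto simp: inst_ok_def)
qed

locale wf_sig =
  fixes \<Psi> :: sig
  assumes wf: "sig_wf \<Psi>"
begin

lemma distinct_names: "distinct (map fst \<Psi>)" and ordered: "sig_ordered \<Psi>"
  and ctx_ok: "(K, \<Gamma>) \<in> set \<Psi> \<Longrightarrow> ctx_ok \<Psi> \<Gamma>"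
  using wf by (auto simp: sig_wf_iff)

lemma scoped: "(K, \<Gamma>) \<in> set \<Psi> \<Longrightarrow> ctx_scoped \<Gamma>"
  using ctx_ok by (simp add: ctx_ok_def)

lemma distinct_vars: "(K, \<Gamma>) \<in> set \<Psi> \<Longrightarrow> distinct (map fst \<Gamma>)"
  using scoped by (simp add: ctx_scoped_def)

lemma ctx_unique: "(K, \<Gamma>) \<in> set \<Psi> \<Longrightarrow> (K, \<Gamma>') \<in> set \<Psi> \<Longrightarrow> \<Gamma> = \<Gamma>'"
  using distinct_names by (rule eq_key_imp_eq_value)

lemma sort_unique: "(K, \<Gamma>) \<in> set \<Psi> \<Longrightarrow> (f, X) \<in> set \<Gamma> \<Longrightarrow> (f, X') \<in> set \<Gamma> \<Longrightarrow> X = X'"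
  using distinct_vars by (rule eq_key_imp_eq_value)

lemma sort_ctx:
  assumes "(K, \<Gamma>) \<in> set \<Psi>" "(f, Y, \<tau>) \<in> set \<Gamma>"
  obtains \<Delta> where "(Y, \<Delta>) \<in> set \<Psi>" "inst_ok \<tau> \<Gamma> \<Delta>"
  using ctx_ok[OF assms(1)] assms(2) unfolding ctx_ok_def by blast

lemma inst_okI:
  assumes "(K, \<Gamma>) \<in> set \<Psi>" "(f, Y, \<tau>) \<in> set \<Gamma>" "(Y, \<Delta>) \<in> set \<Psi>"
  shows "inst_ok \<tau> \<Gamma> \<Delta>"
  using assms ctx_unique sort_ctx by metis

lemma M_in_R_iff:
  "M K Y f \<in> cmor (R \<Psi>) \<longleftrightarrow> (\<exists>\<Gamma> \<tau>. (K, \<Gamma>) \<in> set \<Psi> \<and> (f, Y, \<tau>) \<in> set \<Gamma>)"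
  by (auto simp: cmor_R[OF distinct_names ordered])

lemma Id_in_R_iff: "Id K \<in> cmor (R \<Psi>) \<longleftrightarrow> K \<in> cob (R \<Psi>)"
  by (auto simp: cmor_R[OF distinct_names ordered] cob_R)

lemmas cmp_Id_right = cmp_R_Id_right[OF distinct_names, folded cob_R]
lemmas cmp_Id_left = cmp_R_Id_left[OF distinct_names, folded cob_R]

lemma cmp_eq:
  assumes "(K, \<Gamma>) \<in> set \<Psi>" "(f, Y, \<tau>) \<in> set \<Gamma>" "(Y, \<Delta>) \<in> set \<Psi>"
  shows "cmp (R \<Psi>) (M Y Z g) (M K Y f) = M K Z (interp \<tau> \<Delta> g)"
  using assms by (intro cmp_R distinct_names ordered distinct_vars)

lemma R_mor_ob: "m \<in> cmor (R \<Psi>) \<Longrightarrow> mdom m \<in> cob (R \<Psi>) \<and> mcod m \<in> cob (R \<Psi>)"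
  by (cases m) (auto simp: Id_in_R_iff M_in_R_iff cob_R 
      intro: rev_image_eqI sig_ordered_sorts[OF ordered])

lemma R_cmp_M:
  assumes "M K Y f \<in> cmor (R \<Psi>)" "M Y Z g \<in> cmor (R \<Psi>)"
  obtains h where "cmp (R \<Psi>) (M Y Z g) (M K Y f) = M K Z h" "M K Z h \<in> cmor (R \<Psi>)"
proof -
  obtain \<Gamma> \<tau> \<Delta> \<upsilon> where *: "(K, \<Gamma>) \<in> set \<Psi>" "(f, Y, \<tau>) \<in> set \<Gamma>" "(Y, \<Delta>) \<in> set \<Psi>" "(g, Z, \<upsilon>) \<in> set \<Delta>"
    using assms by (auto simp: M_in_R_iff)
  have "(interp \<tau> \<Delta> g, Z, map (interp \<tau> \<Delta>) \<upsilon>) \<in> set \<Gamma>"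
    using inst_ok_interp(1)[OF inst_okI] * distinct_vars by blast
  then have "M K Z (interp \<tau> \<Delta> g) \<in> cmor (R \<Psi>)" using *(1) by (auto simp: M_in_R_iff)
  then show ?thesis using cmp_eq[OF *(1-3)] that by blast
qed

text \<open>Typing gives \<open>g \<circ> f\<close> the sort \<open>Z\<close> with the substitution
  \<open>map (interp \<tau> \<Delta>) \<upsilon>\<close>, so composing it with \<open>h\<close>
  evaluates a composite substitution; functoriality of \<open>interp\<close> splits the
  value.\<close>

lemma R_cmp_assoc:
  assumes f: "M K Y f \<in> cmor (R \<Psi>)" and g: "M Y Z g \<in> cmor (R \<Psi>)" and h: "M Z W h \<in> cmor (R \<Psi>)"
  shows "cmp (R \<Psi>) (M Z W h) (cmp (R \<Psi>) (M Y Z g) (M K Y f)) =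
         cmp (R \<Psi>) (cmp (R \<Psi>) (M Z W h) (M Y Z g)) (M K Y f)"
proof -
  obtain \<Gamma> \<tau> \<Delta> \<upsilon> \<Theta> \<omega> where *: "(K, \<Gamma>) \<in> set \<Psi>" "(f, Y, \<tau>) \<in> set \<Gamma>" "(Y, \<Delta>) \<in> set \<Psi>" "(g, Z, \<upsilon>) \<in> set \<Delta>"
    "(Z, \<Theta>) \<in> set \<Psi>" "(h, W, \<omega>) \<in> set \<Theta>"
    using assms by (auto simp: M_in_R_iff)
  have gf: "(interp \<tau> \<Delta> g, Z, map (interp \<tau> \<Delta>) \<upsilon>) \<in> set \<Gamma>"
    using inst_ok_interp(1)[OF inst_okI] * distinct_vars by blast
  have "length \<upsilon> = length \<Theta>" using inst_okI[OF *(3,4,5)] by (simp add: inst_ok_def)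
  moreover have "h \<in> fst ` set \<Theta>" using *(6) by force
  ultimately have "interp (map (interp \<tau> \<Delta>) \<upsilon>) \<Theta> h = interp \<tau> \<Delta> (interp \<upsilon> \<Theta> h)"
    by (rule interp_map)
  then show ?thesis
    by (simp add: cmp_eq[OF *(1-3)] cmp_eq[OF *(3-5)] cmp_eq[OF *(1) gf *(5)])
qed

lemma is_category_R: "is_category (R \<Psi>)"
  unfolding is_category_def
proof (intro conjI ballI impI)
  fix K assume "K \<in> cob (R \<Psi>)"
  then show "Id K \<in> cmor (R \<Psi>)" by (simp add: Id_in_R_iff)
next
  fix m assume "m \<in> cmor (R \<Psi>)"
  then show "mdom m \<in> cob (R \<Psi>)" "mcod m \<in> cob (R \<Psi>)" using R_mor_ob by auto
next
  fix f assume "f \<in> cmor (R \<Psi>)"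
  then have "mdom f \<in> cob (R \<Psi>)" using R_mor_ob by blast
  then show "cmp (R \<Psi>) (Id (mcod f)) f = f" "cmp (R \<Psi>) f (Id (mdom f)) = f"
    by (cases f; simp add: cmp_Id_right cmp_Id_left)+
next
  fix f g assume fg: "f \<in> cmor (R \<Psi>)" "g \<in> cmor (R \<Psi>)" "mcod f = mdom g"
  then have ob: "mdom f \<in> cob (R \<Psi>)" using R_mor_ob by blast
  have "cmp (R \<Psi>) g f \<in> cmor (R \<Psi>) \<and> mdom (cmp (R \<Psi>) g f) = mdom f \<and> mcod (cmp (R \<Psi>) g f) = mcod g"
  proof (cases f)
    case (Id K)
    then show ?thesis using fg ob by (simp add: cmp_Id_right)
  next
    case f: (M K Y x)
    show ?thesis
    proof (cases g)
      case (Id Z)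
      then show ?thesis using fg ob f by (simp add: cmp_Id_left)
    next
      case (M Y' Z y)
      then have g: "g = M Y Z y" using fg f by simp
      obtain h where "cmp (R \<Psi>) (M Y Z y) (M K Y x) = M K Z h" "M K Z h \<in> cmor (R \<Psi>)"
        using R_cmp_M fg(1,2) unfolding f g by blast
      then show ?thesis by (simp add: f g)
    qed
  qed
  then show "cmp (R \<Psi>) g f \<in> cmor (R \<Psi>)" "mdom (cmp (R \<Psi>) g f) = mdom f" "mcod (cmp (R \<Psi>) g f) = mcod g"
    by auto
next
  fix f g h assume m: "f \<in> cmor (R \<Psi>)" "g \<in> cmor (R \<Psi>)" "h \<in> cmor (R \<Psi>)"
    and e: "mcod f = mdom g" "mcod g = mdom h"
  have ob: "mdom f \<in> cob (R \<Psi>)" "mdom g \<in> cob (R \<Psi>)" using m R_mor_ob by auto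
  show "cmp (R \<Psi>) h (cmp (R \<Psi>) g f) = cmp (R \<Psi>) (cmp (R \<Psi>) h g) f"
  proof (cases f)
    case (Id K)
    then show ?thesis using ob by (simp add: cmp_Id_right)
  next
    case f: (M K Y x)
    show ?thesis
    proof (cases g)
      case (Id Z)
      then show ?thesis using ob f by (simp add: cmp_Id_left cmp_Id_right)
    next
      case g: (M Y' Z y)
      show ?thesis
      proof (cases h)
        case (Id W)
        have g: "g = M Y Z y" using g f e by simp
        obtain k where "cmp (R \<Psi>) (M Y Z y) (M K Y x) = M K Z k" "M K Z k \<in> cmor (R \<Psi>)"
          using R_cmp_M m(1,2) unfolding f g by blast
        then show ?thesis using ob by (simp add: f g Id cmp_Id_left)
      next
        case (M Z' W z)
        then show ?thesis using f g m e R_cmp_assoc[of K Y x Z y W z] by simp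
      qed
    qed
  qed
qed

lemma M_ordered:
  assumes "M K Y f \<in> cmor (R \<Psi>)"
  shows "\<exists>i j. i < j \<and> j < length (map fst \<Psi>) \<and> map fst \<Psi> ! i = Y \<and> map fst \<Psi> ! j = K"
proof -
  obtain \<Gamma> \<tau> where *: "(K, \<Gamma>) \<in> set \<Psi>" "(f, Y, \<tau>) \<in> set \<Gamma>" using assms by (auto simp: M_in_R_iff)
  then obtain j where j: "j < length \<Psi>" "\<Psi> ! j = (K, \<Gamma>)" by (auto simp: in_set_conv_nth)
  then have "Y \<in> fst ` set (take j \<Psi>)" using ordered *(2) unfolding sig_ordered_def by force
  then obtain i where "i < j" "fst (\<Psi> ! i) = Y" using j(1) by (auto simp: in_set_conv_nth)
  then show ?thesis using j by (intro exI[of _ i] exI[of _ j]) auto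
qed

lemma R_no_endo: "M K K f \<notin> cmor (R \<Psi>)"
proof
  assume "M K K f \<in> cmor (R \<Psi>)"
  then obtain i j where "i < j" "j < length (map fst \<Psi>)" "map fst \<Psi> ! i = K" "map fst \<Psi> ! j = K"
    using M_ordered by blast
  then show False using distinct_names nth_eq_iff_index_eq[of "map fst \<Psi>" i j] by simp
qed

lemma R_no_cycle: "M K Y f \<in> cmor (R \<Psi>) \<Longrightarrow> M Y K g \<notin> cmor (R \<Psi>)"
  using R_cmp_M R_no_endo by metis

theorem is_FIC_R: "is_FIC (R \<Psi>)"
  unfolding is_FIC_def
proof (intro conjI allI impI ballI)
  show "is_category (R \<Psi>)" by (rule is_category_R)
  have "{M K Y f |K Y f \<Gamma> \<tau>. (K, \<Gamma>) \<in> set \<Psi> \<and> (f, Y, \<tau>) \<in> set \<Gamma>} =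
      (\<Union>(K, \<Gamma>)\<in>set \<Psi>. (\<lambda>(f, Y, \<tau>). M K Y f) ` set \<Gamma>)" by force
  then show "finite (cmor (R \<Psi>))"
    by (auto simp: cmor_R[OF distinct_names ordered])
next
  fix K f show "M K K f \<notin> cmor (R \<Psi>)" by (rule R_no_endo)
next
  fix K Y Y' f assume "M K Y f \<in> cmor (R \<Psi>)" "M K Y' f \<in> cmor (R \<Psi>)"
  then show "Y = Y'" using ctx_unique sort_unique by (fastforce simp: M_in_R_iff)
next
  fix X Y
  assume "\<exists>f\<in>cmor (R \<Psi>). \<exists>g\<in>cmor (R \<Psi>). mdom f = X \<and> mcod f = Y \<and> mdom g = Y \<and> mcod g = X \<and>
    cmp (R \<Psi>) g f = Id X \<and> cmp (R \<Psi>) f g = Id Y"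
  then obtain f g where fg: "f \<in> cmor (R \<Psi>)" "g \<in> cmor (R \<Psi>)" "mdom f = X" "mcod f = Y" "mdom g = Y" "mcod g = X"
    by blast
  then show "X = Y" using R_no_cycle by (cases f; cases g) auto
qed

definition sig_down :: "sname \<Rightarrow> mor list" where
  "sig_down K = map (\<lambda>(f, Y, \<tau>). M K Y f) (the (map_of \<Psi> K))"

lemma sig_down_eq: "(K, \<Gamma>) \<in> set \<Psi> \<Longrightarrow> sig_down K = map (\<lambda>(f, Y, \<tau>). M K Y f) \<Gamma>"
  using distinct_names by (simp add: sig_down_def)

lemma adm_obj_order_sig: "adm_obj_order (R \<Psi>) (map fst \<Psi>)"
  unfolding adm_obj_order_def
proof (intro conjI ballI impI)
  fix m assume "m \<in> cmor (R \<Psi>)" "m \<noteq> Id (mdom m)"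
  then show "\<exists>i j. i < j \<and> j < length (map fst \<Psi>) \<and> map fst \<Psi> ! i = mcod m \<and> map fst \<Psi> ! j = mdom m"
    using M_ordered by (cases m) auto
qed (simp_all add: distinct_names cob_R)

lemma adm_down_order_sig: "adm_down_order (R \<Psi>) sig_down"
  unfolding adm_down_order_def
proof (intro ballI conjI impI)
  fix K assume "K \<in> cob (R \<Psi>)"
  then obtain \<Gamma> where K: "(K, \<Gamma>) \<in> set \<Psi>" by (auto simp: cob_R)
  show d: "distinct (sig_down K)"
  proof -
    have "distinct (map mname (sig_down K))"
      using distinct_vars[OF K] by (simp add: sig_down_eq[OF K] case_prod_beta comp_def)
    then show ?thesis by (simp add: distinct_map)
  qed
  show s: "set (sig_down K) = down (R \<Psi>) K"
  proof -
    have "M K Y f \<in> cmor (R \<Psi>) \<longleftrightarrow> (\<exists>\<tau>. (f, Y, \<tau>) \<in> set \<Gamma>)" for Y f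
      using K ctx_unique[OF K] unfolding M_in_R_iff by blast
    then show ?thesis unfolding sig_down_eq[OF K] by (force simp: mem_down_iff)
  qed
  fix f g assume f: "f \<in> down (R \<Psi>) K" and g: "g \<in> cmor (R \<Psi>)" "mdom g = mcod f" "g \<noteq> Id (mdom g)"
  obtain j where j: "j < length \<Gamma>" "sig_down K ! j = f"
    using f unfolding s[symmetric] by (auto simp: sig_down_eq[OF K] in_set_conv_nth)
  obtain x Y \<tau> where x: "\<Gamma> ! j = (x, Y, \<tau>)" by (cases "\<Gamma> ! j")
  have fM: "f = M K Y x" using j x by (simp add: sig_down_eq[OF K])
  have xin: "(x, Y, \<tau>) \<in> set \<Gamma>" using j(1) x by (metis nth_mem)
  obtain Z y where gM: "g = M Y Z y" using g(2,3) fM by (cases g) auto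
  obtain \<Delta> \<upsilon> where \<Delta>: "(Y, \<Delta>) \<in> set \<Psi>" "(y, Z, \<upsilon>) \<in> set \<Delta>" using g(1) gM by (auto simp: M_in_R_iff)
  let ?h = "interp \<tau> \<Delta> y"
  have h: "(?h, Z, map (interp \<tau> \<Delta>) \<upsilon>) \<in> set \<Gamma>" "?h \<in> set \<tau>"
    using inst_ok_interp[OF inst_okI[OF K xin \<Delta>(1)] distinct_vars[OF \<Delta>(1)] \<Delta>(2)] by auto
  have "set \<tau> \<subseteq> fst ` set (take j \<Gamma>)" using scoped[OF K] j(1) x unfolding ctx_scoped_def by fastforce
  \<comment> \<open>Scoping yields an entry named \<open>?h\<close> before position
    \<open>j\<close>, typing yields an entry named \<open>?h\<close> with codomain \<open>Z\<close>;
    uniqueness of variables in \<open>\<Gamma>\<close> makes them the same entry, which is the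
    composite \<open>g \<circ> f\<close>.\<close>
  then obtain X where "(?h, X) \<in> set (take j \<Gamma>)" using h(2) by force
  moreover from this have "X = (Z, map (interp \<tau> \<Delta>) \<upsilon>)" using sort_unique[OF K h(1)] in_set_takeD by fastforce
  ultimately obtain i where i: "i < j" "\<Gamma> ! i = (?h, Z, map (interp \<tau> \<Delta>) \<upsilon>)"
    using j(1) by (auto simp: in_set_conv_nth)
  have "sig_down K ! i = cmp (R \<Psi>) g f"
    using i j(1) by (simp add: sig_down_eq[OF K] fM gM cmp_eq[OF K xin \<Delta>(1)])
  then show "\<exists>i j. i < j \<and> j < length (sig_down K) \<and> sig_down K ! i = cmp (R \<Psi>) g f \<and> sig_down K ! j = f"
    using i j by (intro exI[of _ i] exI[of _ j]) (simp add: sig_down_eq[OF K])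
qed

theorem S_R_eq: "S (R \<Psi>) (map fst \<Psi>) sig_down = \<Psi>"
proof -
  have "T_ctx (R \<Psi>) sig_down K = \<Gamma>" if K: "(K, \<Gamma>) \<in> set \<Psi>" for K \<Gamma>
  proof -
    have "T_entry (R \<Psi>) sig_down (M K Y f) = (f, Y, \<tau>)" if f: "(f, Y, \<tau>) \<in> set \<Gamma>" for f Y \<tau>
    proof -
      obtain \<Delta> where \<Delta>: "(Y, \<Delta>) \<in> set \<Psi>" "inst_ok \<tau> \<Gamma> \<Delta>" using sort_ctx[OF K f] .
      have "map (\<lambda>p. mname (cmp (R \<Psi>) p (M K Y f))) (sig_down Y) = map (interp \<tau> \<Delta>) (map fst \<Delta>)"
        by (auto simp: sig_down_eq[OF \<Delta>(1)] cmp_eq[OF K f \<Delta>(1)])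
      also have "\<dots> = \<tau>"
        using map_interp_vars distinct_vars[OF \<Delta>(1)] \<Delta>(2) by (simp add: inst_ok_def del: map_map)
      finally show ?thesis by (simp add: T_entry_def)
    qed
    then show ?thesis
      unfolding T_ctx_eq sig_down_eq[OF K] map_map by (intro map_idI) auto
  qed
  then show ?thesis unfolding S_def map_map by (intro map_idI) auto
qed

end

section \<open>Independence of the chosen orderings\<close>

text \<open>Both lists are required to be sorted so that a chain of such swaps never leaves the
  linear extensions and each list on the way is again an admissible order.\<close>

definition adj_swap :: "('a \<Rightarrow> 'a \<Rightarrow> bool) \<Rightarrow> 'a list \<Rightarrow> 'a list \<Rightarrow> bool" where
  "adj_swap Q xs ys \<longleftrightarrow> (\<exists>us a b vs. xs = us @ [a, b] @ vs \<and> ys = us @ [b, a] @ vs \<and>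
     sorted_wrt Q xs \<and> sorted_wrt Q ys)"

lemma adj_swaps_sets:
  assumes "(adj_swap Q)\<^sup>*\<^sup>* xs ys"
  shows "set ys = set xs" and "distinct ys \<longleftrightarrow> distinct xs"
proof -
  have "set ys = set xs \<and> (distinct ys \<longleftrightarrow> distinct xs)"
    using assms
  proof (induction rule: rtranclp_induct)
    case (step ys zs)
    obtain us a b vs where "ys = us @ [a, b] @ vs" "zs = us @ [b, a] @ vs"
      using step.hyps(2) unfolding adj_swap_def by blast
    then have "set zs = set ys" "distinct zs \<longleftrightarrow> distinct ys" by auto
    then show ?case using step.IH by simp
  qed simp
  then show "set ys = set xs" "distinct ys \<longleftrightarrow> distinct xs" by auto
qed

lemma adj_swaps_Cons:
  assumes "(adj_swap Q)\<^sup>*\<^sup>* xs ys" "\<And>y. y \<in> set xs \<Longrightarrow> Q u y"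
  shows "(adj_swap Q)\<^sup>*\<^sup>* (u # xs) (u # ys)"
  using assms(1)
proof (induction rule: rtranclp_induct)
  case (step ys zs)
  have "adj_swap Q (u # ys) (u # zs)"
  proof -
    obtain us a b vs where *: "ys = us @ [a, b] @ vs" "zs = us @ [b, a] @ vs"
      "sorted_wrt Q ys" "sorted_wrt Q zs"
      using step.hyps(2) unfolding adj_swap_def by blast
    have "set ys = set xs" "set zs = set ys" using adj_swaps_sets(1)[OF step.hyps(1)] * by auto
    then have "sorted_wrt Q (u # ys)" "sorted_wrt Q (u # zs)" using *(3,4) assms(2) by auto
    then show ?thesis unfolding adj_swap_def using *(1,2) by (metis append_Cons)
  qed
  then show ?case using step.IH by simp
qed simp

lemma adj_swaps_move:
  assumes "sorted_wrt Q (us @ x # vs)" "\<And>u. u \<in> set us \<Longrightarrow> Q x u"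
  shows "(adj_swap Q)\<^sup>*\<^sup>* (x # us @ vs) (us @ x # vs)"
  using assms
proof (induction us)
  case (Cons u us)
  have "adj_swap Q (x # u # us @ vs) (u # x # us @ vs)"
    unfolding adj_swap_def using Cons.prems
    by (intro exI[of _ "[]"] exI[of _ x] exI[of _ u] exI[of _ "us @ vs"]) (auto simp: sorted_wrt_append)
  moreover have "(adj_swap Q)\<^sup>*\<^sup>* (u # x # us @ vs) (u # us @ x # vs)"
    using Cons.prems by (intro adj_swaps_Cons Cons.IH) auto
  ultimately show ?case by simp
qed simp

text \<open>Connect the tail of the first list to \<open>ys\<close> with the head \<open>x\<close>
  deleted, put \<open>x\<close> in front, then move it rightwards to its place. Each
  \<open>u\<close> it passes may stand on either side of \<open>x\<close>: behind it because
  \<open>x\<close> heads the first list, before it because of the second.\<close>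

lemma adj_swaps_connect:
  assumes "distinct xs" "distinct ys" "set xs = set ys" "sorted_wrt Q xs" "sorted_wrt Q ys"
  shows "(adj_swap Q)\<^sup>*\<^sup>* xs ys"
  using assms
proof (induction xs arbitrary: ys)
  case (Cons x xs)
  then obtain us vs where ys: "ys = us @ x # vs" by (metis list.set_intros(1) split_list)
  have s: "set xs = set (us @ vs)" using Cons.prems ys by auto
  have "(adj_swap Q)\<^sup>*\<^sup>* xs (us @ vs)"
    using Cons.prems s by (intro Cons.IH) (auto simp: ys sorted_wrt_append)
  then have "(adj_swap Q)\<^sup>*\<^sup>* (x # xs) (x # us @ vs)"
    using Cons.prems by (intro adj_swaps_Cons) auto
  also have "(adj_swap Q)\<^sup>*\<^sup>* (x # us @ vs) ys"
    unfolding ys using Cons.prems s by (intro adj_swaps_move) (auto simp: ys)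
  finally show ?case .
qed simp

lemma sorted_wrt_swap:
  "sorted_wrt Q (us @ [a, b] @ vs) \<Longrightarrow> Q b a \<Longrightarrow> sorted_wrt Q (us @ [b, a] @ vs)"
  by (auto simp: sorted_wrt_append)

lemma sorted_wrt_adjacent: "sorted_wrt Q (us @ [a, b] @ vs) \<Longrightarrow> Q a b"
  by (simp add: sorted_wrt_append)

lemma swap_at_map: "swap_at (length us) (map h (us @ [a, b] @ vs)) = map h (us @ [b, a] @ vs)"
  by (simp add: swap_at_def nth_append list_update_append)

lemma length_swap_at [simp]: "length (swap_at i \<tau>) = length \<tau>"
  by (simp add: swap_at_def)

lemma swap_at_swap_at: "Suc i < length \<tau> \<Longrightarrow> swap_at i (swap_at i \<tau>) = \<tau>"
  by (rule nth_equalityI) (auto simp: swap_at_def nth_list_update)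

lemma sig_iso_refl: "sig_iso \<Psi> \<Psi>"
  by (simp add: sig_iso_def)

lemma sig_iso_trans: "sig_iso \<Psi> \<Psi>' \<Longrightarrow> sig_iso \<Psi>' \<Psi>'' \<Longrightarrow> sig_iso \<Psi> \<Psi>''"
  unfolding sig_iso_def by (rule equivclp_trans)

lemma sig_swap_imp_iso: "sig_swap \<Psi> \<Psi>' \<Longrightarrow> sig_iso \<Psi> \<Psi>'"
  and sig_ctx_swap_imp_iso: "sig_ctx_swap \<Psi> \<Psi>' \<Longrightarrow> sig_iso \<Psi> \<Psi>'"
  and sig_alpha_imp_iso: "sig_alpha \<Psi> \<Psi>' \<Longrightarrow> sig_iso \<Psi> \<Psi>'"
  unfolding sig_iso_def by (blast intro: r_into_equivclp)+

section \<open>Swaps of signatures as transpositions of the orders\<close>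

context fic_ordered
begin

lemma sorted_os: "sorted_wrt (\<lambda>X Y. \<not> obj_prec L Y X) os"
  using os by (simp add: adm_obj_order_iff)

lemma sorted_ds: "K \<in> cob L \<Longrightarrow> sorted_wrt (\<lambda>f h. \<not> mor_prec L h f) (ds K)"
  using ds by (simp add: adm_down_order_iff)

lemma obj_prec_iff: "obj_prec L A K \<longleftrightarrow> (\<exists>f\<in>down L K. mcod f = A)"
proof
  assume "obj_prec L A K"
  then obtain f where "M K A f \<in> cmor L" by (auto simp: obj_prec_def)
  then show "\<exists>f\<in>down L K. mcod f = A" by (intro bexI[of _ "M K A f"]) (auto simp: mem_down_iff)
next
  assume "\<exists>f\<in>down L K. mcod f = A"
  then obtain f x where "f = M K A x" "f \<in> cmor L" by (auto simp: mem_down_iff)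
  then show "obj_prec L A K" unfolding obj_prec_def by blast
qed

lemma sn_fresh_T_ctx_iff: "K \<in> cob L \<Longrightarrow> sn_fresh A (T_ctx L ds K) \<longleftrightarrow> \<not> obj_prec L A K"
  by (simp add: sn_fresh_def set_T_ctx T_entry_def obj_prec_iff)

text \<open>Names are injective on the morphisms out of \<open>K\<close>, so the name of
  \<open>f\<close> occurs in the sort of \<open>g\<close> exactly when \<open>f\<close> itself is
  some \<open>p \<circ> g\<close>.\<close>

lemma var_fresh_T_entry_iff:
  assumes "f \<in> down L K" "g \<in> down L K"
  shows "var_fresh (mname f) (snd (T_entry L ds g)) \<longleftrightarrow> \<not> mor_prec L f g"
proof -
  have "mname f = mname (cmp L p g) \<longleftrightarrow> f = cmp L p g" if "p \<in> down L (mcod g)" for p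
    using inj_on_eq_iff[OF inj_on_mname assms(1) cmp_down[OF assms(2) that]] .
  then show ?thesis
    using set_ds[OF down_cod[OF assms(2)]] mor_prec_iff[OF assms(2)]
    by (auto simp: var_fresh_def T_entry_def)
qed

text \<open>Congruence of signatures demands freshness both ways: one half is the admissibility of
  the present order, the other that of the swapped one.\<close>

lemma sig_swap_S:
  assumes "os = us @ [A, B] @ vs" "\<not> obj_prec L A B"
  shows "sig_swap (S L os ds) (S L (us @ [B, A] @ vs) ds)"
proof -
  have "\<not> obj_prec L B A" using sorted_wrt_adjacent sorted_os assms(1) by fast
  moreover have "A \<in> cob L" "B \<in> cob L" using assms(1) set_os by auto
  ultimately show ?thesis
    unfolding sig_swap_def S_def assms(1) using assms(2) sn_fresh_T_ctx_iff by simp blast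
qed

text \<open>The order at \<open>K\<close> enters the sort of a morphism \<open>h\<close> only when
  \<open>h\<close> ends in \<open>K\<close>. No such \<open>h\<close> starts at \<open>K\<close> or
  at an earlier object, so there sorts stay as they are; in later contexts such a sort lists the
  composites \<open>p \<circ> h\<close> in the order of the \<open>p\<close>, and
  \<open>swap_at\<close> transposes the two affected ones.\<close>

lemma S_swap_down:
  assumes os_eq: "os = P @ [K] @ Q" and dsK: "ds K = us @ [f, g] @ vs"
  shows "S L os (ds(K := us @ [g, f] @ vs)) =
    S L P ds @ [(K, map (T_entry L ds) (us @ [g, f] @ vs))] @
    map (adjust_entry K (length us)) (S L Q ds)"
proof -
  let ?ds = "ds(K := us @ [g, f] @ vs)"
  have K: "K \<in> cob L" using os_eq set_os by auto
  have ent: "T_entry L ?ds h = T_entry L ds h" if "mcod h \<noteq> K" for h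
    using that by (simp add: T_entry_def)
  have "T_ctx L ?ds X = T_ctx L ds X" if X: "X \<in> set P" for X
  proof -
    have "X \<noteq> K" using X distinct_os os_eq by auto
    have XL: "X \<in> cob L" using X os_eq set_os by auto
    have "\<not> obj_prec L K X" using sorted_os X unfolding os_eq by (simp add: sorted_wrt_append)
    then have "mcod h \<noteq> K" if "h \<in> set (ds X)" for h
      using that set_ds[OF XL] by (auto simp: mem_down_iff obj_prec_def)
    then show ?thesis using \<open>X \<noteq> K\<close> ent by (simp add: T_ctx_eq)
  qed
  then have P: "S L P ?ds = S L P ds" by (simp add: S_def)
  have "T_ctx L ?ds K = map (T_entry L ds) (us @ [g, f] @ vs)"
  proof -
    have "mcod h \<noteq> K" if "h \<in> set (us @ [g, f] @ vs)" for h
      using that set_ds[OF K] dsK down_cod_neq[of h K] by auto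
    then show ?thesis using ent by (simp add: T_ctx_eq)
  qed
  moreover have "(X, T_ctx L ?ds X) = adjust_entry K (length us) (X, T_ctx L ds X)" if X: "X \<in> set Q" for X
  proof -
    have "X \<noteq> K" using X distinct_os os_eq by auto
    moreover have "T_entry L ?ds h =
        (\<lambda>(z, B, \<tau>). (z, B, if B = K then swap_at (length us) \<tau> else \<tau>)) (T_entry L ds h)" for h
      using swap_at_map[of us "\<lambda>p. mname (cmp L p h)" f g vs] dsK by (simp add: T_entry_def)
    ultimately show ?thesis by (simp add: adjust_entry_def T_ctx_eq)
  qed
  ultimately show ?thesis using P by (simp add: S_def os_eq)
qed

lemma sig_ctx_swap_S:
  assumes K: "K \<in> cob L" and dsK: "ds K = us @ [f, g] @ vs" and fg: "\<not> mor_prec L f g"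
  shows "sig_ctx_swap (S L os ds) (S L os (ds(K := us @ [g, f] @ vs)))"
proof -
  obtain P Q where os_eq: "os = P @ [K] @ Q" using K set_os by (metis append_Cons append_Nil split_list)
  have "f \<in> down L K" "g \<in> down L K" using dsK set_ds[OF K] by auto
  moreover have "\<not> mor_prec L g f" using sorted_wrt_adjacent sorted_ds[OF K] dsK by fastforce
  ultimately have "var_fresh (mname f) (snd (T_entry L ds g))" "var_fresh (mname g) (snd (T_entry L ds f))"
    using fg var_fresh_T_entry_iff by auto
  moreover have "S L os ds = S L P ds @ [(K, map (T_entry L ds) us @
      [(mname f, snd (T_entry L ds f)), (mname g, snd (T_entry L ds g))] @ map (T_entry L ds) vs)] @ S L Q ds"
    by (simp add: S_def os_eq T_ctx_eq dsK T_entry_def)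
  moreover have "S L os (ds(K := us @ [g, f] @ vs)) = S L P ds @ [(K, map (T_entry L ds) us @
      [(mname g, snd (T_entry L ds g)), (mname f, snd (T_entry L ds f))] @ map (T_entry L ds) vs)] @
      map (adjust_entry K (length (map (T_entry L ds) us))) (S L Q ds)"
    unfolding S_swap_down[OF os_eq dsK] by (simp add: T_entry_def)
  ultimately show ?thesis unfolding sig_ctx_swap_def by blast
qed

lemma adm_down_order_upd:
  assumes "distinct xs" "set xs = down L K" "sorted_wrt (\<lambda>f h. \<not> mor_prec L h f) xs"
  shows "adm_down_order L (ds(K := xs))"
  using assms ds by (simp add: adm_down_order_iff)

lemma adm_down_order_swap:
  assumes K: "K \<in> cob L" and dsK: "ds K = us @ [f, g] @ vs" and fg: "\<not> mor_prec L f g"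
  shows "adm_down_order L (ds(K := us @ [g, f] @ vs))"
proof (rule adm_down_order_upd)
  show "distinct (us @ [g, f] @ vs)" using distinct_ds[OF K] dsK by auto
  show "set (us @ [g, f] @ vs) = down L K" using set_ds[OF K] dsK by auto
  show "sorted_wrt (\<lambda>f h. \<not> mor_prec L h f) (us @ [g, f] @ vs)"
    using sorted_wrt_swap[of "\<lambda>f h. \<not> mor_prec L h f", OF _ fg] sorted_ds[OF K] dsK by simp
qed

lemma adm_obj_order_swap:
  assumes "os = us @ [A, B] @ vs" "\<not> obj_prec L A B"
  shows "adm_obj_order L (us @ [B, A] @ vs)"
  using assms distinct_os set_os sorted_os
    sorted_wrt_swap[of "\<lambda>X Y. \<not> obj_prec L Y X" us A B vs]
  by (auto simp: adm_obj_order_iff)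

text \<open>\<open>S\<close> consults \<open>ds\<close> at the listed objects and at codomains of
  morphisms, all of which lie in \<open>cob L\<close>; overriding on \<open>cob L\<close> thus
  amounts to replacing \<open>ds\<close>.\<close>

lemma S_cong:
  assumes "\<And>K. K \<in> cob L \<Longrightarrow> ds K = ds' K"
  shows "S L os ds = S L os ds'"
proof -
  have "T_ctx L ds K = T_ctx L ds' K" if K: "K \<in> cob L" for K
  proof -
    have "T_entry L ds f = T_entry L ds' f" if "f \<in> set (ds K)" for f
    proof -
      have "mcod f \<in> cob L" using that set_ds[OF K] down_cod by blast
      then show ?thesis using assms by (simp add: T_entry_def)
    qed
    then show ?thesis using assms[OF K] by (simp add: T_ctx_eq)
  qed
  then show ?thesis using set_os by (simp add: S_def)
qed

end

context fic
begin

lemma sig_iso_S_os: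
  assumes "adm_obj_order L os" "adm_obj_order L os'" "adm_down_order L ds"
  shows "sig_iso (S L os ds) (S L os' ds)"
proof -
  let ?Q = "\<lambda>X Y. \<not> obj_prec L Y X"
  have "(adj_swap ?Q)\<^sup>*\<^sup>* os os'"
    using assms(1,2) by (intro adj_swaps_connect) (auto simp: adm_obj_order_iff)
  then show ?thesis
  proof (induction rule: rtranclp_induct)
    case (step xs ys)
    obtain us A B vs where *: "xs = us @ [A, B] @ vs" "ys = us @ [B, A] @ vs"
      "sorted_wrt ?Q xs" "sorted_wrt ?Q ys"
      using step.hyps(2) unfolding adj_swap_def by blast
    have "adm_obj_order L xs"
      using adj_swaps_sets[OF step.hyps(1)] assms(1) *(3) by (simp add: adm_obj_order_iff)
    then interpret fic_ordered L xs ds using assms(3) by unfold_locales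
    have "\<not> obj_prec L A B" using sorted_wrt_adjacent *(2,4) by fast
    then have "sig_swap (S L xs ds) (S L ys ds)" using sig_swap_S[OF *(1)] *(2) by simp
    then show ?case using step.IH sig_iso_trans sig_swap_imp_iso by blast
  qed (rule sig_iso_refl)
qed

lemma sig_iso_S_ds_upd:
  assumes "adm_obj_order L os" "adm_down_order L ds" "K \<in> cob L"
    and xs: "distinct xs" "set xs = down L K" "sorted_wrt (\<lambda>f h. \<not> mor_prec L h f) xs"
  shows "sig_iso (S L os ds) (S L os (ds(K := xs)))"
proof -
  let ?Q = "\<lambda>f h. \<not> mor_prec L h f"
  interpret base: fic_ordered L os ds using assms by unfold_locales
  have "(adj_swap ?Q)\<^sup>*\<^sup>* (ds K) xs"
    using assms(3) xs base.distinct_ds base.set_ds base.sorted_ds by (intro adj_swaps_connect) auto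
  then show ?thesis
  proof (induction rule: rtranclp_induct)
    case (step ys zs)
    obtain us f g vs where *: "ys = us @ [f, g] @ vs" "zs = us @ [g, f] @ vs"
      "sorted_wrt ?Q ys" "sorted_wrt ?Q zs"
      using step.hyps(2) unfolding adj_swap_def by blast
    have "adm_down_order L (ds(K := ys))"
      using adj_swaps_sets[OF step.hyps(1)] *(3) base.distinct_ds base.set_ds assms(3)
      by (intro base.adm_down_order_upd) auto
    then interpret fic_ordered L os "ds(K := ys)" using assms(1) by unfold_locales
    have "\<not> mor_prec L f g" using sorted_wrt_adjacent *(2,4) by fast
    then have "sig_ctx_swap (S L os (ds(K := ys))) (S L os (ds(K := zs)))"
      using sig_ctx_swap_S[OF assms(3), of us f g vs] *(1,2) by simp
    then show ?case using step.IH sig_iso_trans sig_ctx_swap_imp_iso by blast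
  qed (simp add: sig_iso_refl)
qed

text \<open>The orders are exchanged one object at a time along the finite list \<open>os\<close>;
  admissibility is a separate condition at each object, so every mixture of the two families is
  admissible.\<close>

lemma sig_iso_S_ds:
  assumes "adm_obj_order L os" "adm_down_order L ds" "adm_down_order L ds'"
  shows "sig_iso (S L os ds) (S L os ds')"
proof -
  interpret fic_ordered L os ds using assms by unfold_locales
  have "adm_down_order L (override_on ds ds' (set Ks)) \<and>
      sig_iso (S L os ds) (S L os (override_on ds ds' (set Ks)))" if "set Ks \<subseteq> cob L" for Ks
    using that
  proof (induction Ks)
    case (Cons K Ks)
    let ?e = "override_on ds ds' (set Ks)"
    have eq: "override_on ds ds' (set (K # Ks)) = ?e(K := ds' K)"
      by (auto simp: override_on_def)
    have K: "distinct (ds' K)" "set (ds' K) = down L K" "sorted_wrt (\<lambda>f h. \<not> mor_prec L h f) (ds' K)"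
      using assms(3) Cons.prems by (auto simp: adm_down_order_iff)
    have IH: "adm_down_order L ?e" "sig_iso (S L os ds) (S L os ?e)" using Cons by auto
    have "sig_iso (S L os ?e) (S L os (?e(K := ds' K)))"
      using sig_iso_S_ds_upd[OF assms(1) IH(1) _ K] Cons.prems by simp
    moreover have "adm_down_order L (?e(K := ds' K))"
      using IH(1) K by (simp add: adm_down_order_iff)
    ultimately show ?case unfolding eq using IH(2) sig_iso_trans by blast
  qed (simp add: assms(2) sig_iso_refl)
  from this[of os] have *: "adm_down_order L (override_on ds ds' (cob L))"
    "sig_iso (S L os ds) (S L os (override_on ds ds' (cob L)))"
    using set_os by auto
  interpret o: fic_ordered L os "override_on ds ds' (cob L)" using assms(1) *(1) by unfold_locales
  have "S L os (override_on ds ds' (cob L)) = S L os ds'"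
    by (rule o.S_cong) (simp add: override_on_def)
  then show ?thesis using *(2) by simp
qed

theorem sig_iso_S:
  assumes "adm_obj_order L os" "adm_down_order L ds" "adm_obj_order L os'" "adm_down_order L ds'"
  shows "sig_iso (S L os ds) (S L os' ds')"
  using sig_iso_S_os[OF assms(1,3,2)] sig_iso_S_ds[OF assms(3,2,4)] sig_iso_trans by blast

end

section \<open>Isomorphisms as renamings\<close>

lemma cat_iso_trans:
  assumes "cat_iso C D" "cat_iso D E"
  shows "cat_iso C E"
proof -
  obtain \<phi> \<psi> where 1: "bij_betw \<phi> (cob C) (cob D)" "bij_betw \<psi> (cmor C) (cmor D)"
    "\<And>K. K \<in> cob C \<Longrightarrow> \<psi> (Id K) = Id (\<phi> K)"
    "\<And>m. m \<in> cmor C \<Longrightarrow> mdom (\<psi> m) = \<phi> (mdom m) \<and> mcod (\<psi> m) = \<phi> (mcod m)"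
    "\<And>f g. f \<in> cmor C \<Longrightarrow> g \<in> cmor C \<Longrightarrow> mcod f = mdom g \<Longrightarrow> \<psi> (cmp C g f) = cmp D (\<psi> g) (\<psi> f)"
    using assms(1) unfolding cat_iso_def by blast
  obtain \<phi>' \<psi>' where 2: "bij_betw \<phi>' (cob D) (cob E)" "bij_betw \<psi>' (cmor D) (cmor E)"
    "\<And>K. K \<in> cob D \<Longrightarrow> \<psi>' (Id K) = Id (\<phi>' K)"
    "\<And>m. m \<in> cmor D \<Longrightarrow> mdom (\<psi>' m) = \<phi>' (mdom m) \<and> mcod (\<psi>' m) = \<phi>' (mcod m)"
    "\<And>f g. f \<in> cmor D \<Longrightarrow> g \<in> cmor D \<Longrightarrow> mcod f = mdom g \<Longrightarrow> \<psi>' (cmp D g f) = cmp E (\<psi>' g) (\<psi>' f)"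
    using assms(2) unfolding cat_iso_def by blast
  have ob: "\<phi> K \<in> cob D" if "K \<in> cob C" for K using 1(1) that by (rule bij_betwE[THEN bspec])
  have mor: "\<psi> m \<in> cmor D" if "m \<in> cmor C" for m using 1(2) that by (rule bij_betwE[THEN bspec])
  show ?thesis
    unfolding cat_iso_def
    by (intro exI[of _ "\<phi>' \<circ> \<phi>"] exI[of _ "\<psi>' \<circ> \<psi>"] conjI bij_betw_trans[OF 1(1) 2(1)]
        bij_betw_trans[OF 1(2) 2(2)]) (simp_all add: 1 2 ob mor)
qed

text \<open>Inverting the maps uses that identities, composites and endpoints taken in
  \<open>L\<close> stay in \<open>L\<close>, so \<open>L\<close> is assumed to be a category rather
  than a bare record.\<close>

lemma (in fic) cat_iso_sym:
  assumes "cat_iso L D"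
  shows "cat_iso D L"
proof -
  obtain \<phi> \<psi> where 1: "bij_betw \<phi> (cob L) (cob D)" "bij_betw \<psi> (cmor L) (cmor D)"
    "\<And>K. K \<in> cob L \<Longrightarrow> \<psi> (Id K) = Id (\<phi> K)"
    "\<And>m. m \<in> cmor L \<Longrightarrow> mdom (\<psi> m) = \<phi> (mdom m) \<and> mcod (\<psi> m) = \<phi> (mcod m)"
    "\<And>f g. f \<in> cmor L \<Longrightarrow> g \<in> cmor L \<Longrightarrow> mcod f = mdom g \<Longrightarrow> \<psi> (cmp L g f) = cmp D (\<psi> g) (\<psi> f)"
    using assms(1) unfolding cat_iso_def by blast
  let ?\<phi> = "inv_into (cob L) \<phi>" and ?\<psi> = "inv_into (cmor L) \<psi>"
  have inv\<phi>: "?\<phi> (\<phi> K) = K" if "K \<in> cob L" for K using bij_betw_inv_into_left[OF 1(1) that] .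
  have inv\<psi>: "?\<psi> (\<psi> m) = m" if "m \<in> cmor L" for m using bij_betw_inv_into_left[OF 1(2) that] .
  have ob: "cob D = \<phi> ` cob L" and mor: "cmor D = \<psi> ` cmor L"
    using 1(1,2) by (simp_all add: bij_betw_def)
  have inj: "\<phi> K = \<phi> K' \<longleftrightarrow> K = K'" if "K \<in> cob L" "K' \<in> cob L" for K K'
    using inj_on_eq_iff[OF bij_betw_imp_inj_on[OF 1(1)] that] .
  have "?\<psi> (cmp D (\<psi> g) (\<psi> f)) = cmp L (?\<psi> (\<psi> g)) (?\<psi> (\<psi> f))"
    if "f \<in> cmor L" "g \<in> cmor L" "mcod (\<psi> f) = mdom (\<psi> g)" for f g
  proof -
    have e: "mcod f = mdom g" using that inj 1(4) mdom_ob mcod_ob by simp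
    then have "cmp D (\<psi> g) (\<psi> f) = \<psi> (cmp L g f)" using 1(5) that by simp
    then show ?thesis using inv\<psi> cmp_mor[OF that(1,2) e] that by simp
  qed
  moreover have "?\<psi> (Id (\<phi> K)) = Id (?\<phi> (\<phi> K))" if "K \<in> cob L" for K
    using that 1(3)[symmetric] inv\<psi> inv\<phi> Id_mor by simp
  ultimately show ?thesis
    unfolding cat_iso_def
    by (intro exI[of _ ?\<phi>] exI[of _ ?\<psi>] conjI bij_betw_inv_into 1(1,2))
       (simp_all add: ob mor 1(4) inv\<phi> inv\<psi> mdom_ob mcod_ob)
qed

text \<open>The map on names depends on the domain, since names are required to be distinct only
  among morphisms out of one object; this matches the renaming of variables separately in each entry
  of a signature.\<close>

fun rename_mor :: "(sname \<Rightarrow> sname) \<Rightarrow> (sname \<Rightarrow> var \<Rightarrow> var) \<Rightarrow> mor \<Rightarrow> mor" where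
  "rename_mor \<pi> r (Id K) = Id (\<pi> K)"
| "rename_mor \<pi> r (M K Y f) = M (\<pi> K) (\<pi> Y) (r K f)"

lemma mdom_rename [simp]: "mdom (rename_mor \<pi> r m) = \<pi> (mdom m)"
  and mcod_rename [simp]: "mcod (rename_mor \<pi> r m) = \<pi> (mcod m)"
  by (cases m; simp)+

lemma inj_rename_mor:
  assumes "bij \<pi>" "\<And>K. bij (r K)"
  shows "inj (rename_mor \<pi> r)"
proof (rule injI)
  fix m m' assume "rename_mor \<pi> r m = rename_mor \<pi> r m'"
  then show "m = m'"
    using bij_is_inj[OF assms(1)] bij_is_inj[OF assms(2)] by (cases m; cases m') (auto simp: inj_eq)
qed

text \<open>The maps permute all sort names and all variables, not just those that occur, as
  \<open>sig_alpha\<close> requires.\<close>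

definition cat_rename :: "(sname \<Rightarrow> sname) \<Rightarrow> (sname \<Rightarrow> var \<Rightarrow> var) \<Rightarrow> cat \<Rightarrow> cat \<Rightarrow> bool" where
  "cat_rename \<pi> r L L' \<longleftrightarrow> bij \<pi> \<and> (\<forall>K. bij (r K)) \<and>
     cob L' = \<pi> ` cob L \<and> cmor L' = rename_mor \<pi> r ` cmor L \<and>
     (\<forall>f\<in>cmor L. \<forall>g\<in>cmor L. mcod f = mdom g \<longrightarrow>
        cmp L' (rename_mor \<pi> r g) (rename_mor \<pi> r f) = rename_mor \<pi> r (cmp L g f))"

locale fic_rename = fic +
  fixes \<pi> :: "sname \<Rightarrow> sname" and r :: "sname \<Rightarrow> var \<Rightarrow> var" and L' :: cat
  assumes rename: "cat_rename \<pi> r L L'"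
begin

abbreviation "\<rho> \<equiv> rename_mor \<pi> r"

lemma inj_\<rho>: "inj \<rho>" and inj_\<pi>: "inj \<pi>" and inj_r: "inj (r K)"
  using rename inj_rename_mor by (auto simp: cat_rename_def bij_is_inj)

lemma \<rho>_eq_iff [simp]: "\<rho> m = \<rho> m' \<longleftrightarrow> m = m'"
  and \<pi>_eq_iff [simp]: "\<pi> K = \<pi> K' \<longleftrightarrow> K = K'"
  and r_eq_iff [simp]: "r K x = r K x' \<longleftrightarrow> x = x'"
  using inj_\<rho> inj_\<pi> inj_r by (auto simp: inj_eq)

lemma cob_L': "cob L' = \<pi> ` cob L" and cmor_L': "cmor L' = \<rho> ` cmor L"
  using rename by (simp_all add: cat_rename_def)

lemma cmp_L': "f \<in> cmor L \<Longrightarrow> g \<in> cmor L \<Longrightarrow> mcod f = mdom g \<Longrightarrow> cmp L' (\<rho> g) (\<rho> f) = \<rho> (cmp L g f)"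
  using rename by (simp add: cat_rename_def)

lemma \<rho>_Id_iff: "\<rho> m = Id (\<pi> K) \<longleftrightarrow> m = Id K"
  by (cases m) auto

lemma M_mem_L'E:
  assumes "M A B y \<in> cmor L'"
  obtains K Y x where "A = \<pi> K" "B = \<pi> Y" "y = r K x" "M K Y x \<in> cmor L"
proof -
  obtain m where m: "m \<in> cmor L" "M A B y = \<rho> m" using assms cmor_L' by auto
  then show ?thesis using that by (cases m) auto
qed

lemma cat_iso_rename: "cat_iso L L'"
  unfolding cat_iso_def
proof (intro exI[of _ \<pi>] exI[of _ \<rho>] conjI ballI impI)
  show "bij_betw \<pi> (cob L) (cob L')" "bij_betw \<rho> (cmor L) (cmor L')"
    using inj_\<pi> inj_\<rho> by (auto simp: bij_betw_def cob_L' cmor_L' inj_on_def)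
qed (simp_all add: cmp_L')

lemma is_category_rename: "is_category L'"
  unfolding is_category_def cob_L' cmor_L' ball_simps
proof (intro conjI ballI impI)
  fix K assume "K \<in> cob L"
  then show "Id (\<pi> K) \<in> \<rho> ` cmor L" using Id_mor by (metis image_eqI rename_mor.simps(1))
next
  fix m assume "m \<in> cmor L"
  then show "mdom (\<rho> m) \<in> \<pi> ` cob L" "mcod (\<rho> m) \<in> \<pi> ` cob L" using mdom_ob mcod_ob by simp_all
next
  fix f assume f: "f \<in> cmor L"
  show "cmp L' (Id (mcod (\<rho> f))) (\<rho> f) = \<rho> f"
    using cmp_L'[of f "Id (mcod f)"] f cmp_Id_left Id_mor mcod_ob by simp
  show "cmp L' (\<rho> f) (Id (mdom (\<rho> f))) = \<rho> f"
    using cmp_L'[of "Id (mdom f)" f] f cmp_Id_right Id_mor mdom_ob by simp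
next
  fix f g assume "f \<in> cmor L" "g \<in> cmor L" "mcod (\<rho> f) = mdom (\<rho> g)"
  then show "cmp L' (\<rho> g) (\<rho> f) \<in> \<rho> ` cmor L" "mdom (cmp L' (\<rho> g) (\<rho> f)) = mdom (\<rho> f)"
    "mcod (cmp L' (\<rho> g) (\<rho> f)) = mcod (\<rho> g)"
    by (simp_all add: cmp_L' cmp_mor mdom_cmp mcod_cmp)
next
  fix f g h assume "f \<in> cmor L" "g \<in> cmor L" "h \<in> cmor L" "mcod (\<rho> f) = mdom (\<rho> g)" "mcod (\<rho> g) = mdom (\<rho> h)"
  then show "cmp L' (\<rho> h) (cmp L' (\<rho> g) (\<rho> f)) = cmp L' (cmp L' (\<rho> h) (\<rho> g)) (\<rho> f)"
    by (simp add: cmp_L' cmp_mor mdom_cmp mcod_cmp cmp_assoc)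
qed

lemma is_FIC_rename: "is_FIC L'"
  unfolding is_FIC_def
proof (intro conjI allI impI ballI)
  show "is_category L'" by (rule is_category_rename)
  show "finite (cmor L')" by (simp add: cmor_L' finite_cmor)
next
  fix A y show "M A A y \<notin> cmor L'"
    using no_endo by (auto elim!: M_mem_L'E)
next
  fix A B B' y assume "M A B y \<in> cmor L'" "M A B' y \<in> cmor L'"
  then show "B = B'" using cod_unique by (auto elim!: M_mem_L'E)
next
  fix X Y
  assume "\<exists>f\<in>cmor L'. \<exists>g\<in>cmor L'. mdom f = X \<and> mcod f = Y \<and> mdom g = Y \<and> mcod g = X \<and>
    cmp L' g f = Id X \<and> cmp L' f g = Id Y"
  then obtain f g where fg: "f \<in> cmor L" "g \<in> cmor L" "\<pi> (mdom f) = X" "\<pi> (mcod f) = Y"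
      "\<pi> (mdom g) = Y" "\<pi> (mcod g) = X"
    unfolding cmor_L' by auto
  then have e: "mdom g = mcod f" "mcod g = mdom f" by (metis \<pi>_eq_iff)+
  have "mdom f = mcod f"
    using no_cycle fg(1,2) e by (cases f; cases g) auto
  then show "X = Y" using fg by simp
qed

end

locale fic_ordered_rename = fic_ordered L os ds + fic_rename L \<pi> r L'
  for L os ds \<pi> r L'
begin

definition rename_ds :: "sname \<Rightarrow> mor list" where
  "rename_ds A = map \<rho> (ds (inv \<pi> A))"

lemma rename_ds_eq [simp]: "rename_ds (\<pi> K) = map \<rho> (ds K)"
  by (simp add: rename_ds_def inv_f_f[OF inj_\<pi>])

sublocale target: fic L'
  by unfold_locales (rule is_FIC_rename)

lemma adm_obj_order_rename: "adm_obj_order L' (map \<pi> os)"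
  unfolding target.adm_obj_order_iff
proof (intro conjI)
  show "distinct (map \<pi> os)" using distinct_os inj_\<pi> by (simp add: distinct_map inj_on_def)
  show "set (map \<pi> os) = cob L'" by (simp add: cob_L' set_os)
  have "obj_prec L Y K" if "obj_prec L' (\<pi> Y) (\<pi> K)" for Y K
    using that by (auto simp: obj_prec_def elim!: M_mem_L'E)
  then show "sorted_wrt (\<lambda>X Y. \<not> obj_prec L' Y X) (map \<pi> os)"
    unfolding sorted_wrt_map by (intro sorted_wrt_mono_rel[OF _ sorted_os]) blast
qed

lemma down_rename: "down L' (\<pi> K) = \<rho> ` down L K"
  by (auto simp: down_def cmor_L' \<rho>_Id_iff)

lemma adm_down_order_rename: "adm_down_order L' rename_ds"
  unfolding target.adm_down_order_iff cob_L' ball_simps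
proof (intro ballI conjI)
  fix K assume K: "K \<in> cob L"
  show "distinct (rename_ds (\<pi> K))"
    using distinct_ds[OF K] inj_\<rho> by (simp add: distinct_map inj_on_def)
  show "set (rename_ds (\<pi> K)) = down L' (\<pi> K)" by (simp add: down_rename set_ds[OF K])
  have "mor_prec L h f" if f: "f \<in> cmor L" and hf: "mor_prec L' (\<rho> h) (\<rho> f)" for f h
  proof -
    obtain g where g: "g \<in> cmor L" "mdom g = mcod f" "\<rho> g \<noteq> Id (\<pi> (mdom g))" "\<rho> h = cmp L' (\<rho> g) (\<rho> f)"
      using hf unfolding mor_prec_def cmor_L' by auto
    then have "h = cmp L g f" using cmp_L'[of f g] f by simp
    then show ?thesis using g unfolding mor_prec_def \<rho>_Id_iff by blast
  qed
  then show "sorted_wrt (\<lambda>f h. \<not> mor_prec L' h f) (rename_ds (\<pi> K))"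
    unfolding rename_ds_eq sorted_wrt_map
    by (intro sorted_wrt_mono_rel[OF _ sorted_ds[OF K]]) (use set_ds[OF K] down_mor in blast)
qed

lemma T_ctx_rename:
  assumes K: "K \<in> cob L"
  shows "T_ctx L' rename_ds (\<pi> K) = map (\<lambda>(x, B, \<tau>). (r K x, \<pi> B, map (r K) \<tau>)) (T_ctx L ds K)"
proof -
  have nm: "mname (\<rho> m) = r K (mname m)" if "m \<in> down L K" for m
    using that by (auto simp: mem_down_iff)
  have "T_entry L' rename_ds (\<rho> f) = (\<lambda>(x, B, \<tau>). (r K x, \<pi> B, map (r K) \<tau>)) (T_entry L ds f)"
    if "f \<in> set (ds K)" for f
  proof -
    have f: "f \<in> down L K" using that set_ds[OF K] by simp
    have "mname (cmp L' (\<rho> p) (\<rho> f)) = r K (mname (cmp L p f))" if "p \<in> set (ds (mcod f))" for p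
    proof -
      have p: "p \<in> down L (mcod f)" using that set_ds[OF down_cod[OF f]] by simp
      then show ?thesis
        using cmp_L'[of f p] nm[OF cmp_down[OF f p]] f by (simp add: down_mor down_dom)
    qed
    then show ?thesis using nm[OF f] by (simp add: T_entry_def)
  qed
  then show ?thesis by (simp add: T_ctx_eq)
qed

text \<open>\<open>rename_sig\<close> indexes variable renamings by positions,
  \<open>cat_rename\<close> by objects; the order \<open>os\<close> translates between them.\<close>

lemma S_rename:
  assumes "\<And>i. i < length os \<Longrightarrow> \<sigma> i = r (os ! i)"
  shows "S L' (map \<pi> os) rename_ds = rename_sig \<pi> \<sigma> (S L os ds)"
proof (rule nth_equalityI)
  fix i assume "i < length (S L' (map \<pi> os) rename_ds)"
  then have i: "i < length os" by (simp add: S_def)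
  then have "os ! i \<in> cob L" using set_os nth_mem by blast
  then show "S L' (map \<pi> os) rename_ds ! i = rename_sig \<pi> \<sigma> (S L os ds) ! i"
    using i assms[OF i] T_ctx_rename by (simp add: S_def rename_sig_def)
qed (simp add: S_def rename_sig_def)

end

text \<open>With \<open>B\<close> the image of \<open>A\<close>, the differences
  \<open>B - A\<close> and \<open>A - B\<close> have the same size, so \<open>f\<close> is completed
  by a bijection from the first to the second and by the identity off both sets.\<close>

lemma extend_to_bij:
  fixes f :: "'a \<Rightarrow> 'a"
  assumes "finite A" "inj_on f A"
  shows "\<exists>p. bij p \<and> (\<forall>x\<in>A. p x = f x)"
proof -
  let ?B = "f ` A"
  have "card (?B - A) = card (A - ?B)"
    using assms card_Diff_subset_Int[of ?B A] card_Diff_subset_Int[of A ?B]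
    by (simp add: card_image Int_commute)
  then obtain h where h: "bij_betw h (?B - A) (A - ?B)"
    using assms(1) by (metis finite_Diff finite_imageI finite_same_card_bij)
  define p where "p x = (if x \<in> A then f x else if x \<in> ?B then h x else x)" for x
  have "bij_betw p A ?B"
    using assms(2) by (simp add: bij_betw_def inj_on_def p_def)
  moreover have "bij_betw p (?B - A) (A - ?B)"
    using h by (rule bij_betw_cong[THEN iffD2, rotated]) (simp add: p_def)
  moreover have "bij_betw p (- (A \<union> ?B)) (- (A \<union> ?B))"
    by (rule bij_betw_cong[THEN iffD2, of _ _ id]) (auto simp: p_def)
  ultimately have "bij_betw p (A \<union> (?B - A) \<union> - (A \<union> ?B)) (?B \<union> (A - ?B) \<union> - (A \<union> ?B))"
    by (intro bij_betw_combine) auto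
  moreover have "A \<union> (?B - A) \<union> - (A \<union> ?B) = UNIV" "?B \<union> (A - ?B) \<union> - (A \<union> ?B) = UNIV"
    by auto
  ultimately have "bij p" by simp
  then show ?thesis by (intro exI[of _ p]) (simp add: p_def)
qed

text \<open>Names of morphisms are unique per domain, so the maps on names extend to permutations
  of all names.\<close>
lemma (in fic) cat_iso_imp_rename:
  assumes "cat_iso L L'" "is_FIC L'"
  shows "\<exists>\<pi> r. cat_rename \<pi> r L L'"
proof -
  interpret L': fic L' using assms(2) by unfold_locales
  obtain \<phi> \<psi> where 1: "bij_betw \<phi> (cob L) (cob L')" "bij_betw \<psi> (cmor L) (cmor L')"
    "\<And>K. K \<in> cob L \<Longrightarrow> \<psi> (Id K) = Id (\<phi> K)"
    "\<And>m. m \<in> cmor L \<Longrightarrow> mdom (\<psi> m) = \<phi> (mdom m) \<and> mcod (\<psi> m) = \<phi> (mcod m)"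
    "\<And>f g. f \<in> cmor L \<Longrightarrow> g \<in> cmor L \<Longrightarrow> mcod f = mdom g \<Longrightarrow> \<psi> (cmp L g f) = cmp L' (\<psi> g) (\<psi> f)"
    using assms(1) unfolding cat_iso_def by blast
  have inj\<phi>: "inj_on \<phi> (cob L)" and inj\<psi>: "inj_on \<psi> (cmor L)" using 1(1,2) by (auto simp: bij_betw_def)
  obtain \<pi> where \<pi>: "bij \<pi>" "\<And>K. K \<in> cob L \<Longrightarrow> \<pi> K = \<phi> K"
    using extend_to_bij[OF finite_cob inj\<phi>] by blast
  \<comment> \<open>\<open>m\<close> joins distinct objects and \<open>\<phi>\<close> is injective,
    so \<open>\<psi> m\<close> cannot be an identity.\<close>
  have \<psi>M: "\<psi> m = M (\<phi> K) (\<phi> (mcod m)) (mname (\<psi> m))" if m: "m \<in> down L K" for m K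
  proof -
    have "\<phi> K \<noteq> \<phi> (mcod m)"
      using inj_on_eq_iff[OF inj\<phi>, of K "mcod m"] down_cod_neq[OF m] down_cod[OF m]
        mdom_ob[OF down_mor[OF m]] down_dom[OF m] by auto
    then show ?thesis using 1(4)[OF down_mor[OF m]] down_dom[OF m] by (cases "\<psi> m") auto
  qed
  have "\<exists>p. bij p \<and> (\<forall>m\<in>down L K. p (mname m) = mname (\<psi> m))" for K
  proof -
    let ?q = "\<lambda>x. mname (\<psi> (inv_into (down L K) mname x))"
    have q: "?q (mname m) = mname (\<psi> m)" if "m \<in> down L K" for m
      using inv_into_f_f[OF inj_on_mname that] by simp
    have inj: "inj_on ?q (mname ` down L K)"
    proof (rule inj_onI)
      fix x y assume "x \<in> mname ` down L K" "y \<in> mname ` down L K" and e: "?q x = ?q y"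
      then obtain m n where mn: "m \<in> down L K" "x = mname m" "n \<in> down L K" "y = mname n" by blast
      have nm: "mname (\<psi> m) = mname (\<psi> n)" using e q mn by simp
      have "\<psi> m \<in> cmor L'" "\<psi> n \<in> cmor L'" using 1(2) mn down_mor by (auto simp: bij_betw_def)
      then have "\<psi> m \<in> down L' (\<phi> K)" "\<psi> n \<in> down L' (\<phi> K)"
        using \<psi>M[OF mn(1)] \<psi>M[OF mn(3)] by (auto simp: mem_down_iff)
      then have "\<psi> m = \<psi> n" using nm L'.inj_on_mname by (meson inj_onD)
      then have "m = n" using inj\<psi> mn down_mor by (meson inj_onD)
      then show "x = y" using mn by simp
    qed
    obtain p where p: "bij p" "\<forall>x \<in> mname ` down L K. p x = ?q x"
      using extend_to_bij[OF finite_imageI[OF finite_down] inj] by (elim exE conjE)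
    have "p (mname m) = mname (\<psi> m)" if "m \<in> down L K" for m
      using p(2)[rule_format, OF imageI[OF that]] q[OF that] by simp
    then show ?thesis using p(1) by blast
  qed
  then obtain r where r: "\<And>K. bij (r K)" "\<And>K m. m \<in> down L K \<Longrightarrow> r K (mname m) = mname (\<psi> m)"
    by metis
  have eq: "rename_mor \<pi> r m = \<psi> m" if m: "m \<in> cmor L" for m
  proof (cases m)
    case (Id K)
    then show ?thesis using 1(3) \<pi>(2) mdom_ob[OF m] by simp
  next
    case (M K Y x)
    then have d: "m \<in> down L K" using m by (simp add: mem_down_iff)
    show ?thesis
      using \<psi>M[OF d] r(2)[OF d] \<pi>(2) mdom_ob[OF m] mcod_ob[OF m] by (simp add: M)
  qed
  show ?thesis
    unfolding cat_rename_def
  proof (intro exI[of _ \<pi>] exI[of _ r] conjI allI ballI impI)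
    show "cob L' = \<pi> ` cob L" using 1(1) \<pi>(2) by (simp add: bij_betw_def)
    show "cmor L' = rename_mor \<pi> r ` cmor L" using 1(2) eq by (simp add: bij_betw_def)
  qed (simp_all add: \<pi> r eq 1(5) cmp_mor)
qed

section \<open>Invariance under isomorphism\<close>

lemma length_rename_sig [simp]: "length (rename_sig \<pi> \<rho> \<Psi>) = length \<Psi>"
  by (simp add: rename_sig_def)

lemma nth_rename_sig:
  "i < length \<Psi> \<Longrightarrow> rename_sig \<pi> \<rho> \<Psi> ! i =
     (\<pi> (fst (\<Psi> ! i)), map (\<lambda>(x, B, \<tau>). (\<rho> i x, \<pi> B, map (\<rho> i) \<tau>)) (snd (\<Psi> ! i)))"
  by (simp add: rename_sig_def case_prod_beta)

lemma sig_alpha_sym: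
  assumes "sig_alpha \<Psi> \<Psi>'"
  shows "sig_alpha \<Psi>' \<Psi>"
proof -
  obtain \<pi> \<rho> where *: "bij \<pi>" "\<And>i. bij (\<rho> i)" "\<Psi>' = rename_sig \<pi> \<rho> \<Psi>"
    using assms by (auto simp: sig_alpha_def)
  have inv: "inv \<pi> (\<pi> K) = K" "inv (\<rho> i) (\<rho> i x) = x" for K i x
    using *(1,2) by (simp_all add: bij_is_inj inv_f_f)
  have "\<Psi> = rename_sig (inv \<pi>) (\<lambda>i. inv (\<rho> i)) \<Psi>'"
  proof (rule nth_equalityI)
    fix i assume "i < length \<Psi>"
    moreover have "map (\<lambda>(x, B, \<tau>). (inv (\<rho> i) x, inv \<pi> B, map (inv (\<rho> i)) \<tau>))
        (map (\<lambda>(x, B, \<tau>). (\<rho> i x, \<pi> B, map (\<rho> i) \<tau>)) \<Gamma>) = \<Gamma>" for \<Gamma>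
      unfolding map_map by (rule map_idI) (auto simp: inv comp_def)
    ultimately show "\<Psi> ! i = rename_sig (inv \<pi>) (\<lambda>i. inv (\<rho> i)) \<Psi>' ! i"
      by (simp add: *(3) nth_rename_sig inv del: map_map)
  qed (simp add: *(3))
  then show ?thesis
    unfolding sig_alpha_def
    by (intro exI[of _ "inv \<pi>"] exI[of _ "\<lambda>i. inv (\<rho> i)"] conjI allI bij_imp_bij_inv *(1,2))
qed

lemma sig_swap_sym: "sig_swap \<Psi> \<Psi>' \<Longrightarrow> sig_swap \<Psi>' \<Psi>"
  unfolding sig_swap_def by blast

context wf_sig
begin

sublocale fic_ordered "R \<Psi>" "map fst \<Psi>" sig_down
  by unfold_locales (rule is_FIC_R adm_obj_order_sig adm_down_order_sig)+

lemma T_ctx_sig: "(K, \<Gamma>) \<in> set \<Psi> \<Longrightarrow> T_ctx (R \<Psi>) sig_down K = \<Gamma>"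
  using mem_S_iff[of K \<Gamma>] by (simp add: S_R_eq)

text \<open>Freshness of \<open>A\<close> in the context of \<open>B\<close> makes the transposed
  list of names an admissible order of the same category, and \<open>S\<close> with that order is
  the swapped signature.\<close>

lemma sig_swap_wf_iso:
  assumes "sig_swap \<Psi> \<Psi>'"
  shows "sig_wf \<Psi>' \<and> cat_iso (R \<Psi>) (R \<Psi>')"
proof -
  obtain P A \<Gamma> B \<Delta> \<Phi> where eq: "\<Psi> = P @ [(A, \<Gamma>), (B, \<Delta>)] @ \<Phi>" "\<Psi>' = P @ [(B, \<Delta>), (A, \<Gamma>)] @ \<Phi>"
    and fr: "sn_fresh A \<Delta>"
    using assms unfolding sig_swap_def by blast
  have AB: "(A, \<Gamma>) \<in> set \<Psi>" "(B, \<Delta>) \<in> set \<Psi>" using eq(1) by auto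
  have "B \<in> cob (R \<Psi>)" using AB(2) by (force simp: cob_R)
  then have "\<not> obj_prec (R \<Psi>) A B" using fr sn_fresh_T_ctx_iff[of B A] T_ctx_sig[OF AB(2)] by simp
  then have "adm_obj_order (R \<Psi>) (map fst \<Psi>')"
    using adm_obj_order_swap[of "map fst P" A B "map fst \<Phi>"] eq by simp
  then interpret s: fic_ordered "R \<Psi>" "map fst \<Psi>'" sig_down
    using ds by unfold_locales
  have "(fst e, T_ctx (R \<Psi>) sig_down (fst e)) = e" if "e \<in> set \<Psi>'" for e
    using T_ctx_sig[of "fst e" "snd e"] that eq by auto
  then have "S (R \<Psi>) (map fst \<Psi>') sig_down = \<Psi>'"
    unfolding S_def map_map by (intro map_idI) simp
  then have "sig_wf \<Psi>'" "cat_iso (R \<Psi>') (R \<Psi>)" using s.sig_wf_S s.cat_iso_R_S by auto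
  then show ?thesis using fic.cat_iso_sym fic.intro wf_sig.is_FIC_R wf_sig.intro by blast
qed

lemma sig_ctx_swap_wf_iso:
  assumes "sig_ctx_swap \<Psi> \<Psi>'"
  shows "sig_wf \<Psi>' \<and> cat_iso (R \<Psi>) (R \<Psi>')"
proof -
  obtain P A G1 x X y Y G2 \<Phi> where
    eq: "\<Psi> = P @ [(A, G1 @ [(x, X), (y, Y)] @ G2)] @ \<Phi>"
      "\<Psi>' = P @ [(A, G1 @ [(y, Y), (x, X)] @ G2)] @ map (adjust_entry A (length G1)) \<Phi>"
    and fr: "var_fresh x Y"
    using assms unfolding sig_ctx_swap_def by blast
  have A: "(A, G1 @ [(x, X), (y, Y)] @ G2) \<in> set \<Psi>" using eq(1) by simp
  have Aob: "A \<in> cob (R \<Psi>)" using A by (force simp: cob_R)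
  have "map (T_entry (R \<Psi>) sig_down) (sig_down A) = G1 @ [(x, X), (y, Y)] @ G2"
    using T_ctx_sig[OF A] by (simp add: T_ctx_eq)
  \<comment> \<open>The context is the entrywise image of \<open>sig_down A\<close>, so the
    splitting of the context pulls back to a splitting of the order at \<open>A\<close>.\<close>
  then obtain us f g vs where dsA: "sig_down A = us @ [f, g] @ vs"
    and ent: "map (T_entry (R \<Psi>) sig_down) us = G1" "T_entry (R \<Psi>) sig_down f = (x, X)"
      "T_entry (R \<Psi>) sig_down g = (y, Y)" "map (T_entry (R \<Psi>) sig_down) vs = G2"
    by (auto simp: map_eq_append_conv map_eq_Cons_conv)
  have fg: "f \<in> down (R \<Psi>) A" "g \<in> down (R \<Psi>) A" using set_ds[OF Aob] dsA by auto
  have "mname f = x" using ent(2) by (simp add: T_entry_def)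
  then have nprec: "\<not> mor_prec (R \<Psi>) f g" using var_fresh_T_entry_iff[OF fg] ent(3) fr by simp
  let ?ds = "sig_down(A := us @ [g, f] @ vs)"
  have "S (R \<Psi>) (map fst \<Psi>) ?ds = S (R \<Psi>) (map fst P) sig_down @
      [(A, map (T_entry (R \<Psi>) sig_down) (us @ [g, f] @ vs))] @
      map (adjust_entry A (length us)) (S (R \<Psi>) (map fst \<Phi>) sig_down)"
  proof (rule S_swap_down[OF _ dsA])
    show "map fst \<Psi> = map fst P @ [A] @ map fst \<Phi>" by (simp add: eq(1))
  qed
  also have "S (R \<Psi>) (map fst P) sig_down = P"
    using T_ctx_sig eq(1) unfolding S_def map_map by (intro map_idI) auto
  also have "S (R \<Psi>) (map fst \<Phi>) sig_down = \<Phi>"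
    using T_ctx_sig eq(1) unfolding S_def map_map by (intro map_idI) auto
  also have "length us = length G1" using ent(1) by auto
  also have "map (T_entry (R \<Psi>) sig_down) (us @ [g, f] @ vs) = G1 @ [(y, Y), (x, X)] @ G2"
    by (simp add: ent)
  finally have S: "S (R \<Psi>) (map fst \<Psi>) ?ds = \<Psi>'" unfolding eq(2) .
  interpret s: fic_ordered "R \<Psi>" "map fst \<Psi>" ?ds
    using os adm_down_order_swap[OF Aob dsA nprec] by unfold_locales
  have "sig_wf \<Psi>'" "cat_iso (R \<Psi>') (R \<Psi>)" using s.sig_wf_S s.cat_iso_R_S S by auto
  then show ?thesis using fic.cat_iso_sym fic.intro wf_sig.is_FIC_R wf_sig.intro by blast
qed

text \<open>\<open>swap_at\<close> is an involution only on long enough lists, which is guaranteed by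
  the target signature being derivable.\<close>
lemma sig_ctx_swap_sym:
  assumes "sig_ctx_swap \<Psi>' \<Psi>"
  shows "sig_ctx_swap \<Psi> \<Psi>'"
proof -
  obtain P A G1 x X y Y G2 \<Phi> where
    eq: "\<Psi>' = P @ [(A, G1 @ [(x, X), (y, Y)] @ G2)] @ \<Phi>"
      "\<Psi> = P @ [(A, G1 @ [(y, Y), (x, X)] @ G2)] @ map (adjust_entry A (length G1)) \<Phi>"
    and fr: "var_fresh x Y" "var_fresh y X"
    using assms unfolding sig_ctx_swap_def by blast
  let ?i = "length G1"
  have A: "(A, G1 @ [(y, Y), (x, X)] @ G2) \<in> set \<Psi>" by (simp add: eq(2))
  have "adjust_entry A ?i (adjust_entry A ?i e) = e" if e: "e \<in> set \<Phi>" for e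
  proof -
    obtain K \<Gamma> where K: "e = (K, \<Gamma>)" by (cases e)
    have ad: "adjust_entry A ?i e \<in> set \<Psi>" using e by (simp add: eq(2))
    have "(if B = A then swap_at ?i (if B = A then swap_at ?i \<tau> else \<tau>) else (if B = A then swap_at ?i \<tau> else \<tau>)) = \<tau>"
      if z: "(z, B, \<tau>) \<in> set \<Gamma>" for z B \<tau>
    proof (cases "B = A")
      case True
      have "(z, A, swap_at ?i \<tau>) \<in> set (snd (adjust_entry A ?i e))"
        using z True by (force simp: K adjust_entry_def)
      then have "inst_ok (swap_at ?i \<tau>) (snd (adjust_entry A ?i e)) (G1 @ [(y, Y), (x, X)] @ G2)"
        using inst_okI[OF _ _ A] ad by (metis prod.collapse)
      then have "Suc ?i < length \<tau>" by (simp add: inst_ok_def)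
      then show ?thesis by (simp add: swap_at_swap_at)
    qed simp
    then show ?thesis
      unfolding K adjust_entry_def by (auto simp: comp_def intro!: map_idI)
  qed
  then have "map (adjust_entry A ?i) (map (adjust_entry A ?i) \<Phi>) = \<Phi>"
    unfolding map_map by (intro map_idI) simp
  then show ?thesis
    unfolding sig_ctx_swap_def using eq fr by metis
qed

lemma sig_alpha_wf_iso:
  assumes "sig_alpha \<Psi> \<Psi>'"
  shows "sig_wf \<Psi>' \<and> cat_iso (R \<Psi>) (R \<Psi>')"
proof -
  obtain \<pi> \<sigma> where *: "bij \<pi>" "\<And>i. bij (\<sigma> i)" "\<Psi>' = rename_sig \<pi> \<sigma> \<Psi>"
    using assms by (auto simp: sig_alpha_def)
  let ?os = "map fst \<Psi>"
  \<comment> \<open>\<open>\<sigma>\<close> is indexed by entries, \<open>r\<close> by objects: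
    \<open>K\<close> takes the renaming of the one entry named \<open>K\<close>. For a
    \<open>K\<close> not listed the description is unspecified, yet \<open>r K\<close> is some
    \<open>\<sigma> i\<close> and thus still a bijection.\<close>
  define r where "r K = \<sigma> (THE i. i < length ?os \<and> ?os ! i = K)" for K
  have r: "\<sigma> i = r (?os ! i)" if "i < length ?os" for i
  proof -
    have "(THE j. j < length ?os \<and> ?os ! j = ?os ! i) = i"
      using that distinct_names by (intro the_equality) (auto simp: nth_eq_iff_index_eq simp del: nth_map)
    then show ?thesis by (simp add: r_def)
  qed
  let ?\<rho> = "rename_mor \<pi> r"
  \<comment> \<open>The renamed category arises by transport of structure along the injective
    \<open>?\<rho>\<close>; composites are pulled back with its inverse.\<close>
  define L' where "L' = \<lparr>cob = \<pi> ` cob (R \<Psi>), cmor = ?\<rho> ` cmor (R \<Psi>),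
     cmp = (\<lambda>g f. ?\<rho> (cmp (R \<Psi>) (inv ?\<rho> g) (inv ?\<rho> f)))\<rparr>"
  have br: "bij (r K)" for K by (simp add: r_def *(2))
  have "cat_rename \<pi> r (R \<Psi>) L'"
    using inv_f_f[OF inj_rename_mor[OF *(1) br]] *(1) br by (simp add: cat_rename_def L'_def)
  then interpret ren: fic_ordered_rename "R \<Psi>" ?os sig_down \<pi> r L'
    by unfold_locales
  have S: "S L' (map \<pi> ?os) ren.rename_ds = \<Psi>'"
    using ren.S_rename[OF r] by (simp add: S_R_eq *(3))
  interpret s: fic_ordered L' "map \<pi> ?os" ren.rename_ds
    using ren.adm_obj_order_rename ren.adm_down_order_rename by unfold_locales
  have "sig_wf \<Psi>'" "cat_iso (R \<Psi>') L'" using s.sig_wf_S s.cat_iso_R_S S by auto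
  moreover from this have "cat_iso L' (R \<Psi>')"
    using fic.cat_iso_sym fic.intro wf_sig.is_FIC_R wf_sig.intro by blast
  ultimately show ?thesis using ren.cat_iso_rename cat_iso_trans by blast
qed

text \<open>Chains for \<open>sig_iso\<close> run in both directions through signatures that are not
  assumed derivable. Derivability is therefore carried along in the induction, and a backward step
  is turned round starting from its derivable end.\<close>

theorem sig_iso_wf_iso:
  assumes "sig_iso \<Psi> \<Psi>'"
  shows "sig_wf \<Psi>' \<and> cat_iso (R \<Psi>) (R \<Psi>')"
  using assms unfolding sig_iso_def
proof (induction rule: equivclp_induct)
  case base
  have "cat_iso (R \<Psi>) (R \<Psi>)"
    unfolding cat_iso_def by (intro exI[of _ id]) simp
  then show ?case using wf by simp
next
  case (step \<Phi> \<Phi>')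
  then interpret \<Phi>: wf_sig \<Phi> by unfold_locales simp
  have "sig_swap \<Phi> \<Phi>' \<or> sig_ctx_swap \<Phi> \<Phi>' \<or> sig_alpha \<Phi> \<Phi>'"
    using step.hyps(2) sig_swap_sym sig_alpha_sym \<Phi>.sig_ctx_swap_sym by blast
  then have "sig_wf \<Phi>' \<and> cat_iso (R \<Phi>) (R \<Phi>')"
    using \<Phi>.sig_swap_wf_iso \<Phi>.sig_ctx_swap_wf_iso \<Phi>.sig_alpha_wf_iso by blast
  then show ?case using step.IH cat_iso_trans by blast
qed

end

text \<open>The isomorphism is replaced by a renaming, which gives an alpha step to
  \<open>L'\<close> with the transported orders; from there to the given orders only transpositions
  remain.\<close>

lemma (in fic_ordered) sig_iso_S_cat_iso:
  assumes "is_FIC L'" "cat_iso L L'" "adm_obj_order L' os'" "adm_down_order L' ds'"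
  shows "sig_iso (S L os ds) (S L' os' ds')"
proof -
  obtain \<pi> r where ren: "cat_rename \<pi> r L L'" using cat_iso_imp_rename[OF assms(2,1)] by blast
  then interpret ren: fic_ordered_rename L os ds \<pi> r L' by unfold_locales
  have "sig_alpha (S L os ds) (S L' (map \<pi> os) ren.rename_ds)"
    unfolding sig_alpha_def
    using ren by (intro exI[of _ \<pi>] exI[of _ "\<lambda>i. r (os ! i)"] conjI ren.S_rename) (simp_all add: cat_rename_def)
  then have "sig_iso (S L os ds) (S L' (map \<pi> os) ren.rename_ds)" by (rule sig_alpha_imp_iso)
  moreover have "sig_iso (S L' (map \<pi> os) ren.rename_ds) (S L' os' ds')"
    by (intro ren.target.sig_iso_S ren.adm_obj_order_rename ren.adm_down_order_rename assms)
  ultimately show ?thesis by (rule sig_iso_trans)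
qed

theorem mainTheorem1:
  shows
    \<comment> \<open>R sends derivable signatures to finite inverse categories ...\<close>
    "(\<forall>\<Psi>. sig_wf \<Psi> \<longrightarrow> is_FIC (R \<Psi>))
   \<comment> \<open>... and respects isomorphism, so R : Sig -> FIC is well defined\<close>
   \<and> (\<forall>\<Psi> \<Psi>'. sig_wf \<Psi> \<and> sig_wf \<Psi>' \<and> sig_iso \<Psi> \<Psi>' \<longrightarrow> cat_iso (R \<Psi>) (R \<Psi>'))
   \<comment> \<open>admissible orderings exist for every finite inverse category\<close>
   \<and> (\<forall>L. is_FIC L \<longrightarrow> (\<exists>os ds. adm_obj_order L os \<and> adm_down_order L ds))
   \<comment> \<open>S produces derivable signatures ...\<close>
   \<and> (\<forall>L os ds. is_FIC L \<and> adm_obj_order L os \<and> adm_down_order L ds \<longrightarrow> sig_wf (S L os ds))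
   \<comment> \<open>... independently of the choices and of the representative: S : FIC -> Sig well defined\<close>
   \<and> (\<forall>L L' os ds os' ds'. is_FIC L \<and> is_FIC L' \<and> cat_iso L L'
        \<and> adm_obj_order L os \<and> adm_down_order L ds \<and> adm_obj_order L' os' \<and> adm_down_order L' ds'
        \<longrightarrow> sig_iso (S L os ds) (S L' os' ds'))
   \<comment> \<open>S o R = id on Sig\<close>
   \<and> (\<forall>\<Psi> os ds. sig_wf \<Psi> \<and> adm_obj_order (R \<Psi>) os \<and> adm_down_order (R \<Psi>) ds
        \<longrightarrow> sig_iso (S (R \<Psi>) os ds) \<Psi>)
   \<comment> \<open>R o S = id on FIC\<close>
   \<and> (\<forall>L os ds. is_FIC L \<and> adm_obj_order L os \<and> adm_down_order L ds
        \<longrightarrow> cat_iso (R (S L os ds)) L)"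
proof (intro conjI allI impI; (elim conjE)?)
  fix \<Psi> assume "sig_wf \<Psi>"
  then interpret wf_sig \<Psi> by unfold_locales
  show "is_FIC (R \<Psi>)" by (rule is_FIC_R)
next
  fix \<Psi> \<Psi>' assume "sig_wf \<Psi>" "sig_iso \<Psi> \<Psi>'"
  then show "cat_iso (R \<Psi>) (R \<Psi>')" using wf_sig.sig_iso_wf_iso wf_sig.intro by blast
next
  fix L assume "is_FIC L"
  then show "\<exists>os ds. adm_obj_order L os \<and> adm_down_order L ds"
    using fic.adm_orders_exist fic.intro by blast
next
  fix L os ds assume "is_FIC L" "adm_obj_order L os" "adm_down_order L ds"
  then interpret fic_ordered L os ds by unfold_locales
  show "sig_wf (S L os ds)" by (rule sig_wf_S)
  show "cat_iso (R (S L os ds)) L" by (rule cat_iso_R_S)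
next
  fix L L' os ds os' ds'
  assume "is_FIC L" "adm_obj_order L os" "adm_down_order L ds"
  then interpret fic_ordered L os ds by unfold_locales
  assume "is_FIC L'" "cat_iso L L'" "adm_obj_order L' os'" "adm_down_order L' ds'"
  then show "sig_iso (S L os ds) (S L' os' ds')" by (rule sig_iso_S_cat_iso)
next
  fix \<Psi> os ds assume "sig_wf \<Psi>" and o: "adm_obj_order (R \<Psi>) os" "adm_down_order (R \<Psi>) ds"
  then interpret wf_sig \<Psi> by unfold_locales
  \<comment> \<open>The given orders are compared with those that \<open>\<Psi>\<close> itself
    displays, for which \<open>S\<close> returns \<open>\<Psi>\<close> exactly.\<close>
  have "sig_iso (S (R \<Psi>) os ds) (S (R \<Psi>) (map fst \<Psi>) sig_down)"
    by (intro sig_iso_S o adm_obj_order_sig adm_down_order_sig)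
  then show "sig_iso (S (R \<Psi>) os ds) \<Psi>" by (simp add: S_R_eq)
qed

end
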